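(* Let $X_{\mathrm{AH}}$ be a Banach space which has very few operators, has a shrinking Schauder basis, and whose dual space is isomorphic to $\ell_1$. Let $Y$ be a closed, infinite-dimensional subspace of $X_{\mathrm{AH}}$ such that: (i) $Y$ is the closed linear span of a subsequence of the Schauder basis for $X_{\mathrm{AH}}$; (ii) $Y$ has infinite codimension in $X_{\mathrm{AH}}$; (iii) $Y^*$ is isomorphic to $\ell_1$; (iv) every bounded operator from $Y$ into $X_{\mathrm{AH}}$ is the sum of a scalar multiple of the inclusion map $J\colon Y\to X_{\mathrm{AH}}$ and a compact operator. Let $Z=X_{\mathrm{AH}}\oplus Y$. Then the Banach algebra $\mathscr{B}(Z)$ of bounded operators on $Z$ is not amenable.
   Context: The scalar field is $\mathbb{K}=\mathbb{R}$ or $\mathbb{C}$. A Banach space $E$ has very few operators if $E$ is infinite-dimensional and every bounded operator on $E$ is the sum of a scalar multiple of the identity operator $I_E$ and a compact operator. $Z$ carries the norm $\|(x,y)\|=\max\{\|x\|,\|y\|\}$. A Banach algebra $\mathscr{A}$ is amenable if every bounded derivation from $\mathscr{A}$ into a dual Banach $\mathscr{A}$-bimodule is inner. *)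

theory Defs
  imports "HOL-Analysis.Analysis" "HOL-Algebra.Module" "HOL-Algebra.AbelCoset"
    "HOL-Algebra.Algebraic_Closure_Type"
begin

section \<open>The scalar field\<close>

text \<open>Up to isometric isomorphism, the real and the complex numbers are the only types in this
  class.\<close>

class real_or_complex = real_normed_field +
  assumes real_or_complex:
    "(\<forall>z. \<exists>a. z = a *\<^sub>R 1) \<or>
     (\<exists>i. i * i = - 1 \<and> (\<forall>z. \<exists>a b. z = a *\<^sub>R 1 + b *\<^sub>R i) \<and>
          (\<forall>a b. norm (a *\<^sub>R 1 + b *\<^sub>R i) = sqrt (a\<^sup>2 + b\<^sup>2)))"

instance real :: real_or_complex
  by standard auto

instance complex :: real_or_complex
proof
  have "\<exists>a b. z = a *\<^sub>R 1 + b *\<^sub>R \<i>" for z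
    by (intro exI[of _ "Re z"] exI[of _ "Im z"]) (simp add: complex_eq_iff)
  moreover have "norm (a *\<^sub>R 1 + b *\<^sub>R \<i>) = sqrt (a\<^sup>2 + b\<^sup>2)" for a b
    by (simp add: cmod_def)
  ultimately show "(\<forall>z::complex. \<exists>a. z = a *\<^sub>R 1) \<or>
     (\<exists>i::complex. i * i = - 1 \<and> (\<forall>z. \<exists>a b. z = a *\<^sub>R 1 + b *\<^sub>R i) \<and>
          (\<forall>a b. norm (a *\<^sub>R 1 + b *\<^sub>R i) = sqrt (a\<^sup>2 + b\<^sup>2)))"
    by (intro disjI2 exI[of _ \<i>]) auto
qed


section \<open>Banach spaces over the scalar field\<close>

text \<open>The multiplicative fields inherited from the record of rings are used for Banach algebras
  only and are ignored for plain normed spaces.\<close>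

record ('k, 'a) normed_module = "('k, 'a) module" +
  vnorm :: "'a \<Rightarrow> real"

locale normed_space = module "ring_of_type_algebra :: 'k ring" E
  for E :: "('k::real_or_complex, 'a, 'm) normed_module_scheme" (structure) +
  assumes vnorm_nonneg: "x \<in> carrier E \<Longrightarrow> 0 \<le> vnorm E x"
    and vnorm_eq_zero: "x \<in> carrier E \<Longrightarrow> vnorm E x = 0 \<longleftrightarrow> x = \<zero>"
    and vnorm_triangle:
      "\<lbrakk>x \<in> carrier E; y \<in> carrier E\<rbrakk> \<Longrightarrow> vnorm E (x \<oplus> y) \<le> vnorm E x + vnorm E y"
    and vnorm_smult: "x \<in> carrier E \<Longrightarrow> vnorm E (c \<odot> x) = norm c * vnorm E x"

text \<open>The value outside the carrier is fixed because the locale \<open>Metric_space\<close> requires symmetry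
  and non-negativity on the whole type.\<close>

definition vdist :: "('k, 'a, 'm) normed_module_scheme \<Rightarrow> 'a \<Rightarrow> 'a \<Rightarrow> real" where
  "vdist E x y = (if x \<in> carrier E \<and> y \<in> carrier E then vnorm E (x \<ominus>\<^bsub>E\<^esub> y) else 0)"

definition norm_topology :: "('k, 'a, 'm) normed_module_scheme \<Rightarrow> 'a topology" where
  "norm_topology E = Metric_space.mtopology (carrier E) (vdist E)"

definition banach_space :: "('k::real_or_complex, 'a, 'm) normed_module_scheme \<Rightarrow> bool" where
  "banach_space E \<longleftrightarrow> normed_space E \<and> Metric_space.mcomplete (carrier E) (vdist E)"

lemma (in normed_space) Metric_space_vdist: "Metric_space (carrier E) (vdist E)"
proof
  have minus: "vnorm E (\<ominus> x) = vnorm E x" if "x \<in> carrier E" for x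
  proof -
    have "(- 1) \<odot> x \<oplus> x = (- 1) \<odot> x \<oplus> 1 \<odot> x"
      using smult_one[OF that] by (simp add: ring_of_type_algebra_def)
    also have "\<dots> = (- 1 + 1) \<odot> x"
      using smult_l_distr[of "- 1" 1 x] that by (simp add: ring_of_type_algebra_def)
    also have "\<dots> = \<zero>"
      using smult_l_null[OF that] by (simp add: ring_of_type_algebra_def)
    finally have "(- 1) \<odot> x = \<ominus> x"
      using that smult_closed[of "- 1" x]
      by (simp add: M.minus_equality ring_of_type_algebra_def)
    then show ?thesis
      using vnorm_smult[OF that, of "- 1"] by simp
  qed
  show "0 \<le> vdist E x y" for x y
    by (simp add: vdist_def vnorm_nonneg)
  show "vdist E x y = vdist E y x" for x y
  proof (cases "x \<in> carrier E \<and> y \<in> carrier E")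
    case True
    then have "\<ominus> (x \<ominus> y) = y \<ominus> x"
      by (simp add: a_minus_def M.minus_add M.a_comm)
    with True show ?thesis
      using minus[of "x \<ominus> y"] by (simp add: vdist_def)
  qed (auto simp: vdist_def)
  show "vdist E x y = 0 \<longleftrightarrow> x = y" if "x \<in> carrier E" "y \<in> carrier E" for x y
    using that by (auto simp: vdist_def vnorm_eq_zero M.r_neg a_minus_def dest: M.minus_equality)
  show "vdist E x z \<le> vdist E x y + vdist E y z"
    if "x \<in> carrier E" "y \<in> carrier E" "z \<in> carrier E" for x y z
  proof -
    have "x \<ominus> z = (x \<ominus> y) \<oplus> (y \<ominus> z)"
      using that by (simp add: a_minus_def M.a_assoc M.r_neg1)
    then show ?thesis
      using that vnorm_triangle[of "x \<ominus> y" "y \<ominus> z"] by (simp add: vdist_def)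
  qed
qed


section \<open>Linear span, dimension, codimension\<close>

definition lin_span :: "('k::real_or_complex, 'a, 'm) module_scheme \<Rightarrow> 'a set \<Rightarrow> 'a set" where
  "lin_span E S = \<Inter>{H. submodule H (ring_of_type_algebra :: 'k ring) E \<and> S \<subseteq> H}"

definition infinite_dimensional :: "('k::real_or_complex, 'a, 'm) module_scheme \<Rightarrow> bool" where
  "infinite_dimensional E \<longleftrightarrow> \<not> (\<exists>S. finite S \<and> S \<subseteq> carrier E \<and> lin_span E S = carrier E)"

definition quotient_module ::
    "('k, 'a, 'm) module_scheme \<Rightarrow> 'a set \<Rightarrow> ('k, 'a set) module" where
  "quotient_module E Y =
     \<lparr>carrier = a_rcosets\<^bsub>E\<^esub> Y, mult = undefined, one = undefined,
      zero = Y, add = (\<lambda>C D. C <+>\<^bsub>E\<^esub> D),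
      smult = (\<lambda>c C. \<Union>x\<in>C. Y +>\<^bsub>E\<^esub> (c \<odot>\<^bsub>E\<^esub> x))\<rparr>"

definition infinite_codimension ::
    "('k::real_or_complex, 'a, 'm) module_scheme \<Rightarrow> 'a set \<Rightarrow> bool" where
  "infinite_codimension E Y \<longleftrightarrow> infinite_dimensional (quotient_module E Y)"

definition closed_span ::
    "('k::real_or_complex, 'a, 'm) normed_module_scheme \<Rightarrow> 'a set \<Rightarrow> 'a set" where
  "closed_span E S = norm_topology E closure_of lin_span E S"


section \<open>Bounded and compact operators\<close>

text \<open>An operator is a function which is \<open>undefined\<close> outside the carrier of its domain.\<close>

definition linear_maps ::
    "('k, 'a, 'm) module_scheme \<Rightarrow> ('k, 'b, 'n) module_scheme \<Rightarrow> ('a \<Rightarrow> 'b) set" where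
  "linear_maps E F =
     {T \<in> carrier E \<rightarrow>\<^sub>E carrier F.
        (\<forall>x\<in>carrier E. \<forall>y\<in>carrier E. T (x \<oplus>\<^bsub>E\<^esub> y) = T x \<oplus>\<^bsub>F\<^esub> T y) \<and>
        (\<forall>c. \<forall>x\<in>carrier E. T (c \<odot>\<^bsub>E\<^esub> x) = c \<odot>\<^bsub>F\<^esub> T x)}"

definition bounded_operators ::
    "('k, 'a, 'm) normed_module_scheme \<Rightarrow> ('k, 'b, 'n) normed_module_scheme \<Rightarrow> ('a \<Rightarrow> 'b) set"
  where
  "bounded_operators E F =
     {T \<in> linear_maps E F. \<exists>C. \<forall>x\<in>carrier E. vnorm F (T x) \<le> C * vnorm E x}"

definition compact_operators ::
    "('k, 'a, 'm) normed_module_scheme \<Rightarrow> ('k, 'b, 'n) normed_module_scheme \<Rightarrow> ('a \<Rightarrow> 'b) set"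
  where
  "compact_operators E F =
     {T \<in> linear_maps E F.
        compactin (norm_topology F)
          (norm_topology F closure_of (T ` {x \<in> carrier E. vnorm E x \<le> 1}))}"

definition operator_space ::
    "('k, 'a, 'm) normed_module_scheme \<Rightarrow> ('k, 'b, 'n) normed_module_scheme \<Rightarrow>
     ('k, 'a \<Rightarrow> 'b) normed_module" where
  "operator_space E F =
     \<lparr>carrier = bounded_operators E F, mult = undefined, one = undefined,
      zero = (\<lambda>x\<in>carrier E. \<zero>\<^bsub>F\<^esub>),
      add = (\<lambda>S T. \<lambda>x\<in>carrier E. S x \<oplus>\<^bsub>F\<^esub> T x),
      smult = (\<lambda>c T. \<lambda>x\<in>carrier E. c \<odot>\<^bsub>F\<^esub> T x),
      vnorm = (\<lambda>T. SUP x\<in>{x \<in> carrier E. vnorm E x \<le> 1}. vnorm F (T x))\<rparr>"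

definition operator_algebra ::
    "('k, 'a, 'm) normed_module_scheme \<Rightarrow> ('k, 'a \<Rightarrow> 'a) normed_module" where
  "operator_algebra E =
     (operator_space E E)\<lparr>mult := compose (carrier E), one := (\<lambda>x\<in>carrier E. x)\<rparr>"

definition isomorphic_spaces ::
    "('k, 'a, 'm) normed_module_scheme \<Rightarrow> ('k, 'b, 'n) normed_module_scheme \<Rightarrow> bool" where
  "isomorphic_spaces E F \<longleftrightarrow>
     (\<exists>T\<in>bounded_operators E F. \<exists>S\<in>bounded_operators F E.
        (\<forall>x\<in>carrier E. S (T x) = x) \<and> (\<forall>y\<in>carrier F. T (S y) = y))"

definition scalar_plus_compact ::
    "('k, 'a, 'm) normed_module_scheme \<Rightarrow> ('k, 'b, 'n) normed_module_scheme \<Rightarrow>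
     ('a \<Rightarrow> 'b) \<Rightarrow> ('a \<Rightarrow> 'b) \<Rightarrow> bool" where
  "scalar_plus_compact E F J T \<longleftrightarrow>
     (\<exists>c. \<exists>K\<in>compact_operators E F.
        T = c \<odot>\<^bsub>operator_space E F\<^esub> J \<oplus>\<^bsub>operator_space E F\<^esub> K)"

definition very_few_operators ::
    "('k::real_or_complex, 'a, 'm) normed_module_scheme \<Rightarrow> bool" where
  "very_few_operators E \<longleftrightarrow>
     infinite_dimensional E \<and>
     (\<forall>T\<in>bounded_operators E E. scalar_plus_compact E E (\<lambda>x\<in>carrier E. x) T)"


section \<open>Duals, sequence spaces and direct sums\<close>

definition scalar_space :: "('k::real_or_complex, 'k) normed_module" where
  "scalar_space =
     \<lparr>carrier = UNIV, mult = (*), one = 1, zero = 0, add = (+), smult = (*), vnorm = norm\<rparr>"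

definition dual_space ::
    "('k::real_or_complex, 'a, 'm) normed_module_scheme \<Rightarrow> ('k, 'a \<Rightarrow> 'k) normed_module" where
  "dual_space E = operator_space E scalar_space"

definition ell1 :: "('k::real_or_complex, nat \<Rightarrow> 'k) normed_module" where
  "ell1 =
     \<lparr>carrier = {x. summable (\<lambda>n. norm (x n))}, mult = undefined, one = undefined,
      zero = (\<lambda>n. 0), add = (\<lambda>x y n. x n + y n), smult = (\<lambda>c x n. c * x n),
      vnorm = (\<lambda>x. \<Sum>n. norm (x n))\<rparr>"

definition max_sum ::
    "('k, 'a, 'm) normed_module_scheme \<Rightarrow> ('k, 'b, 'n) normed_module_scheme \<Rightarrow>
     ('k, 'a \<times> 'b) normed_module" where
  "max_sum E F =
     \<lparr>carrier = carrier E \<times> carrier F, mult = undefined, one = undefined,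
      zero = (\<zero>\<^bsub>E\<^esub>, \<zero>\<^bsub>F\<^esub>),
      add = (\<lambda>(x, y) (x', y'). (x \<oplus>\<^bsub>E\<^esub> x', y \<oplus>\<^bsub>F\<^esub> y')),
      smult = (\<lambda>c (x, y). (c \<odot>\<^bsub>E\<^esub> x, c \<odot>\<^bsub>F\<^esub> y)),
      vnorm = (\<lambda>(x, y). max (vnorm E x) (vnorm F y))\<rparr>"


section \<open>Schauder bases\<close>

definition expands ::
    "('k, 'a, 'm) normed_module_scheme \<Rightarrow> (nat \<Rightarrow> 'a) \<Rightarrow> (nat \<Rightarrow> 'k) \<Rightarrow> 'a \<Rightarrow> bool" where
  "expands E e a x \<longleftrightarrow>
     limitin (norm_topology E) (\<lambda>N. \<Oplus>\<^bsub>E\<^esub>n\<in>{..<N}. a n \<odot>\<^bsub>E\<^esub> e n) x sequentially"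

definition schauder_basis ::
    "('k, 'a, 'm) normed_module_scheme \<Rightarrow> (nat \<Rightarrow> 'a) \<Rightarrow> bool" where
  "schauder_basis E e \<longleftrightarrow> range e \<subseteq> carrier E \<and> (\<forall>x\<in>carrier E. \<exists>!a. expands E e a x)"

definition coordinate_functional ::
    "('k, 'a, 'm) normed_module_scheme \<Rightarrow> (nat \<Rightarrow> 'a) \<Rightarrow> nat \<Rightarrow> 'a \<Rightarrow> 'k" where
  "coordinate_functional E e n = (\<lambda>x\<in>carrier E. (THE a. expands E e a x) n)"

definition shrinking_basis ::
    "('k::real_or_complex, 'a, 'm) normed_module_scheme \<Rightarrow> (nat \<Rightarrow> 'a) \<Rightarrow> bool" where
  "shrinking_basis E e \<longleftrightarrow>
     schauder_basis E e \<and>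
     closed_span (dual_space E) (range (coordinate_functional E e)) = carrier (dual_space E)"


section \<open>Amenability\<close>

definition bounded_bilinear_map ::
    "('k, 'a, 'm) normed_module_scheme \<Rightarrow> ('k, 'b, 'n) normed_module_scheme \<Rightarrow>
     ('k, 'c, 'l) normed_module_scheme \<Rightarrow> ('a \<Rightarrow> 'b \<Rightarrow> 'c) \<Rightarrow> bool" where
  "bounded_bilinear_map E F G b \<longleftrightarrow>
     (\<forall>x\<in>carrier E. (\<lambda>y\<in>carrier F. b x y) \<in> linear_maps F G) \<and>
     (\<forall>y\<in>carrier F. (\<lambda>x\<in>carrier E. b x y) \<in> linear_maps E G) \<and>
     (\<exists>C. \<forall>x\<in>carrier E. \<forall>y\<in>carrier F. vnorm G (b x y) \<le> C * vnorm E x * vnorm F y)"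

definition banach_bimodule ::
    "('k::real_or_complex, 'a, 'm) normed_module_scheme \<Rightarrow> ('k, 'e, 'n) normed_module_scheme \<Rightarrow>
     ('a \<Rightarrow> 'e \<Rightarrow> 'e) \<Rightarrow> ('e \<Rightarrow> 'a \<Rightarrow> 'e) \<Rightarrow> bool" where
  "banach_bimodule A E l r \<longleftrightarrow>
     banach_space E \<and> bounded_bilinear_map A E E l \<and> bounded_bilinear_map E A E r \<and>
     (\<forall>a\<in>carrier A. \<forall>b\<in>carrier A. \<forall>x\<in>carrier E.
        l (a \<otimes>\<^bsub>A\<^esub> b) x = l a (l b x) \<and> r x (a \<otimes>\<^bsub>A\<^esub> b) = r (r x a) b \<and>
        r (l a x) b = l a (r x b))"

definition dual_left_action ::
    "('k, 'e, 'n) normed_module_scheme \<Rightarrow> ('e \<Rightarrow> 'a \<Rightarrow> 'e) \<Rightarrow> 'a \<Rightarrow> ('e \<Rightarrow> 'k) \<Rightarrow> 'e \<Rightarrow> 'k" where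
  "dual_left_action E r a f = (\<lambda>x\<in>carrier E. f (r x a))"

definition dual_right_action ::
    "('k, 'e, 'n) normed_module_scheme \<Rightarrow> ('a \<Rightarrow> 'e \<Rightarrow> 'e) \<Rightarrow> ('e \<Rightarrow> 'k) \<Rightarrow> 'a \<Rightarrow> 'e \<Rightarrow> 'k" where
  "dual_right_action E l f a = (\<lambda>x\<in>carrier E. f (l a x))"

definition bounded_derivation ::
    "('k, 'a, 'm) normed_module_scheme \<Rightarrow> ('k, 'd, 'n) normed_module_scheme \<Rightarrow>
     ('a \<Rightarrow> 'd \<Rightarrow> 'd) \<Rightarrow> ('d \<Rightarrow> 'a \<Rightarrow> 'd) \<Rightarrow> ('a \<Rightarrow> 'd) \<Rightarrow> bool" where
  "bounded_derivation A V l r D \<longleftrightarrow>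
     D \<in> bounded_operators A V \<and>
     (\<forall>a\<in>carrier A. \<forall>b\<in>carrier A. D (a \<otimes>\<^bsub>A\<^esub> b) = l a (D b) \<oplus>\<^bsub>V\<^esub> r (D a) b)"

definition inner_derivation ::
    "('k, 'a, 'm) normed_module_scheme \<Rightarrow> ('k, 'd, 'n) normed_module_scheme \<Rightarrow>
     ('a \<Rightarrow> 'd \<Rightarrow> 'd) \<Rightarrow> ('d \<Rightarrow> 'a \<Rightarrow> 'd) \<Rightarrow> ('a \<Rightarrow> 'd) \<Rightarrow> bool" where
  "inner_derivation A V l r D \<longleftrightarrow>
     (\<exists>v\<in>carrier V. \<forall>a\<in>carrier A. D a = l a v \<ominus>\<^bsub>V\<^esub> r v a)"

text \<open>The definition of amenability quantifies over all Banach \<open>A\<close>-bimodules \<open>E\<close>; here \<open>E\<close> ranges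
  over all those whose underlying set is a subset of the type \<open>'a \<Rightarrow> 'k\<close>.  For a Banach algebra \<open>A\<close>
  this is no restriction.  Suppose that all bounded derivations into duals of such bimodules are
  inner, let \<open>E\<close> be arbitrary and let \<open>D\<close> be a bounded derivation into the dual of \<open>E\<close>
  (with \<open>A \<noteq> 0\<close>, so that \<open>A\<close> has at least the cardinality of the continuum).
  A closed sub-bimodule \<open>F\<close> of \<open>E\<close> generated by at most \<open>|A|\<close> elements has at most
  \<open>|A|\<^bsup>\<aleph>\<^sub>0\<^esup> \<le> 2\<^bsup>|A|\<^esup>\<close> elements, hence is isomorphic to one with underlying set in \<open>'a \<Rightarrow> 'k\<close>, so that
  the restriction of \<open>D\<close> to \<open>F\<close> is implemented by some functional on \<open>F\<close>.  The minimal norms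
  of these functionals are bounded independently of \<open>F\<close>, because countably many such \<open>F\<close>
  are contained in another one; a weak-* limit point, along the directed set of the \<open>F\<close>, of
  norm-preserving extensions to \<open>E\<close> then implements \<open>D\<close>.\<close>

definition amenable :: "('k::real_or_complex, 'a, 'm) normed_module_scheme \<Rightarrow> bool" where
  "amenable A \<longleftrightarrow>
     (\<forall>(E :: ('k, 'a \<Rightarrow> 'k) normed_module) l r D.
        banach_bimodule A E l r \<and>
        bounded_derivation A (dual_space E) (dual_left_action E r) (dual_right_action E l) D
        \<longrightarrow> inner_derivation A (dual_space E) (dual_left_action E r) (dual_right_action E l) D)"

end

theory Submission
  imports Defs
begin

text \<open>Write an operator on \<open>Z = X \<oplus> Y\<close> as a \<open>2 \<times> 2\<close> matrix of operators. Each entry, regarded as a map into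
  \<open>X\<close>, is a scalar multiple of the inclusion plus a compact operator. The scalar is unique and bounded
  by the norm since \<open>X\<close> and \<open>Y\<close> are infinite-dimensional, and it vanishes for the entry from \<open>X\<close> to \<open>Y\<close>
  since \<open>Y\<close> has infinite codimension. Hence \<open>\<B>(Z)\<close> is mapped homomorphically onto the upper triangular
  \<open>2 \<times> 2\<close> matrices, whose off-diagonal entry is a bounded derivation into a one-dimensional dual
  bimodule. It is not inner, because it does not vanish on the operator \<open>(x, y) \<mapsto> (y, 0)\<close>, both of whose
  diagonal scalars are zero.

  Compactness enters through finite partitions of the unit ball: \<open>K\<close> is compact only if for each
  \<open>\<epsilon> > 0\<close> there is such a partition with \<open>\<parallel>K (x - y)\<parallel> < \<epsilon>\<close> for all \<open>x, y\<close> in a common cell. The sets of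
  differences \<open>x - y\<close> of this kind generate a filter, along which \<open>\<parallel>T u - c u\<parallel>\<close> tends to \<open>0\<close> when \<open>T - c\<close>
  is compact.\<close>

section \<open>Normed spaces\<close>

lemma scalar_ring_simps [simp]:
  "carrier ring_of_type_algebra = UNIV"
  "a \<oplus>\<^bsub>ring_of_type_algebra\<^esub> b = a + b"
  "a \<otimes>\<^bsub>ring_of_type_algebra\<^esub> b = a * b"
  "\<zero>\<^bsub>ring_of_type_algebra\<^esub> = 0"
  "\<one>\<^bsub>ring_of_type_algebra\<^esub> = 1"
  by (simp_all add: ring_of_type_algebra_def)

abbreviation (input) subspace_of :: "'a set \<Rightarrow> ('k::real_or_complex, 'a, 'm) module_scheme \<Rightarrow> bool" where
  "subspace_of D E \<equiv> submodule D (ring_of_type_algebra :: 'k ring) E"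

context normed_space
begin

lemma smult_in_carrier [simp]: "x \<in> carrier E \<Longrightarrow> c \<odot> x \<in> carrier E"
  using smult_closed[of c x] by simp

lemma smult_simps [simp]:
  assumes "x \<in> carrier E"
  shows "1 \<odot> x = x" "0 \<odot> x = \<zero>" "a \<odot> (b \<odot> x) = (a * b) \<odot> x"
  using smult_one[OF assms] smult_l_null[OF assms] smult_assoc1[of a b x] assms by simp_all

lemma smult_zero_right [simp]: "c \<odot> \<zero> = \<zero>"
  using smult_r_null[of c] by simp

lemma smult_add_left: "x \<in> carrier E \<Longrightarrow> (a + b) \<odot> x = a \<odot> x \<oplus> b \<odot> x"
  using smult_l_distr[of a b x] by simp

lemma smult_add_right:
  "x \<in> carrier E \<Longrightarrow> y \<in> carrier E \<Longrightarrow> c \<odot> (x \<oplus> y) = c \<odot> x \<oplus> c \<odot> y"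
  using smult_r_distr[of c x y] by simp

lemma minus_eq_smult: "x \<in> carrier E \<Longrightarrow> \<ominus> x = (- 1) \<odot> x"
  using smult_add_left[of x "-1" 1] by (simp add: M.minus_equality)

lemma diff_eq_smult: "x \<in> carrier E \<Longrightarrow> x' \<in> carrier E \<Longrightarrow> x \<ominus> x' = x \<oplus> (- 1) \<odot> x'"
  by (simp add: a_minus_def minus_eq_smult)

lemma diff_zero [simp]: "x \<in> carrier E \<Longrightarrow> x \<ominus> \<zero> = x"
  by (simp add: diff_eq_smult)

lemma diff_diff_eq:
  "x \<in> carrier E \<Longrightarrow> y \<in> carrier E \<Longrightarrow> z \<in> carrier E \<Longrightarrow> x \<ominus> y \<ominus> z = x \<ominus> (y \<oplus> z)"
  by (simp add: diff_eq_smult smult_add_right M.a_assoc)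

lemma add_diff_cancel [simp]: "x \<in> carrier E \<Longrightarrow> y \<in> carrier E \<Longrightarrow> (x \<oplus> y) \<ominus> y = x"
  by (simp add: a_minus_def M.a_assoc M.r_neg)

lemma vnorm_zero [simp]: "vnorm E \<zero> = 0"
  by (simp add: vnorm_eq_zero)

lemma vnorm_diff_le:
  "x \<in> carrier E \<Longrightarrow> y \<in> carrier E \<Longrightarrow> vnorm E (x \<ominus> y) \<le> vnorm E x + vnorm E y"
  using vnorm_triangle[of x "(- 1) \<odot> y"] by (simp add: diff_eq_smult vnorm_smult)

lemma subspaceD:
  assumes "subspace_of D E"
  shows "x \<in> D \<Longrightarrow> x \<in> carrier E" "\<zero> \<in> D" "x \<in> D \<Longrightarrow> c \<odot> x \<in> D"
    "x \<in> D \<Longrightarrow> y \<in> D \<Longrightarrow> x \<oplus> y \<in> D" "x \<in> D \<Longrightarrow> y \<in> D \<Longrightarrow> x \<ominus> y \<in> D"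
  using submoduleE[OF assms] subgroup.one_closed[OF submodule.axioms(1)[OF assms]]
  by (auto simp: a_minus_def)

lemma subspace_carrier: "subspace_of (carrier E) E"
  by (rule carrier_is_submodule)

lemma normed_space_subspace:
  assumes "subspace_of D E"
  shows "normed_space (E\<lparr>carrier := D\<rparr>)"
proof -
  interpret D: module "ring_of_type_algebra :: 'k ring" "E\<lparr>carrier := D\<rparr>"
    by (rule submodule.submodule_is_module[OF assms module_axioms])
  show ?thesis
    by unfold_locales
      (use subspaceD(1)[OF assms] in
        \<open>auto simp: vnorm_nonneg vnorm_eq_zero vnorm_smult intro: vnorm_triangle\<close>)
qed

text \<open>Outside a closed set every point has a ball that misses the set. In this metric form
  closedness enters the series argument below, where the subspace may be \<open>Y\<close> or
  zero.\<close>

lemma closed_subspaceD: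
  assumes "closedin (norm_topology E) W" and x: "x \<in> carrier E"
    and approx: "\<And>\<epsilon>. \<epsilon> > 0 \<Longrightarrow> \<exists>w\<in>W. vnorm E (x \<ominus> w) < \<epsilon>"
  shows "x \<in> W"
proof (rule ccontr)
  interpret Metric_space "carrier E" "vdist E"
    by (rule Metric_space_vdist)
  assume "x \<notin> W"
  with assms(1) x obtain r where "r > 0" "disjnt W (mball x r)" and "W \<subseteq> carrier E"
    unfolding norm_topology_def closedin_metric by auto
  moreover obtain w where "w \<in> W" "vnorm E (x \<ominus> w) < r"
    using approx[OF \<open>r > 0\<close>] by blast
  ultimately show False
    using x by (auto simp: disjnt_iff in_mball vdist_def)
qed

section \<open>Differences of points in the same cell of a finite partition of the unit ball\<close>

text \<open>The cells are the level sets of a labelling \<open>l\<close> with finite range. Natural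
  numbers suffice as labels of a finite partition and keep the existential within one type. Only
  labels of points of \<open>D\<close> in the unit ball matter.\<close>

definition ball_diffs :: "'a set \<Rightarrow> 'a filter" where
  "ball_diffs D = Abs_filter (\<lambda>P. \<exists>l :: 'a \<Rightarrow> nat. finite (range l) \<and>
     (\<forall>x\<in>D. \<forall>y\<in>D. vnorm E x \<le> 1 \<longrightarrow> vnorm E y \<le> 1 \<longrightarrow> l x = l y \<longrightarrow> P (x \<ominus> y)))"

lemma eventually_ball_diffs:
  "eventually P (ball_diffs D) \<longleftrightarrow> (\<exists>l :: 'a \<Rightarrow> nat. finite (range l) \<and>
     (\<forall>x\<in>D. \<forall>y\<in>D. vnorm E x \<le> 1 \<longrightarrow> vnorm E y \<le> 1 \<longrightarrow> l x = l y \<longrightarrow> P (x \<ominus> y)))"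
  unfolding ball_diffs_def
proof (rule eventually_Abs_filter, rule is_filter.intro, goal_cases)
  case 1
  show ?case by (rule exI[of _ "\<lambda>_. 0"]) simp
next
  case (2 P Q)
  then obtain l m :: "'a \<Rightarrow> nat" where lm: "finite (range l)" "finite (range m)"
    "\<forall>x\<in>D. \<forall>y\<in>D. vnorm E x \<le> 1 \<longrightarrow> vnorm E y \<le> 1 \<longrightarrow> l x = l y \<longrightarrow> P (x \<ominus> y)"
    "\<forall>x\<in>D. \<forall>y\<in>D. vnorm E x \<le> 1 \<longrightarrow> vnorm E y \<le> 1 \<longrightarrow> m x = m y \<longrightarrow> Q (x \<ominus> y)"
    by blast
  \<comment> \<open>The pair of labels, coded as one number, describes the common refinement of the
    two partitions.\<close>
  have "range (\<lambda>x. prod_encode (l x, m x)) \<subseteq> prod_encode ` (range l \<times> range m)"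
    by auto
  then have "finite (range (\<lambda>x. prod_encode (l x, m x)))"
    using lm(1,2) by (meson finite_SigmaI finite_imageI finite_subset)
  with lm(3,4) show ?case
    by (intro exI[of _ "\<lambda>x. prod_encode (l x, m x)"]) (simp add: prod_encode_eq)
next
  case (3 P Q)
  then show ?case by blast
qed

lemma eventually_ball_diffs_in:
  assumes "subspace_of D E"
  shows "eventually (\<lambda>u. u \<in> D \<and> vnorm E u \<le> 2) (ball_diffs D)"
  unfolding eventually_ball_diffs
proof (intro exI[of _ "\<lambda>_. 0"] conjI ballI impI)
  fix x y assume xy: "x \<in> D" "y \<in> D" "vnorm E x \<le> 1" "vnorm E y \<le> 1"
  then show "x \<ominus> y \<in> D"
    using subspaceD[OF assms] by blast
  show "vnorm E (x \<ominus> y) \<le> 2"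
    using vnorm_diff_le[of x y] subspaceD[OF assms] xy by force
qed auto

text \<open>A partition of the unit ball of \<open>D'\<close> pulls back along \<open>T\<close>,
  which sends the unit ball of \<open>D\<close> into it and differences to differences. This makes
  essential scalars multiplicative under composition.\<close>

lemma filterlim_ball_diffs:
  assumes D: "subspace_of D E" and D': "subspace_of D' E"
    and T: "\<And>x. x \<in> D \<Longrightarrow> T x \<in> D'"
    and diff: "\<And>x y. x \<in> D \<Longrightarrow> y \<in> D \<Longrightarrow> T (x \<ominus> y) = T x \<ominus> T y"
    and contr: "\<And>x. x \<in> D \<Longrightarrow> vnorm E (T x) \<le> vnorm E x"
  shows "filterlim T (ball_diffs D') (ball_diffs D)"
proof (rule filterlim_iff[THEN iffD2], intro allI impI)
  fix P assume "eventually P (ball_diffs D')"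
  then obtain l :: "'a \<Rightarrow> nat" where l: "finite (range l)"
    "\<forall>x\<in>D'. \<forall>y\<in>D'. vnorm E x \<le> 1 \<longrightarrow> vnorm E y \<le> 1 \<longrightarrow> l x = l y \<longrightarrow> P (x \<ominus> y)"
    unfolding eventually_ball_diffs by blast
  show "eventually (\<lambda>x. P (T x)) (ball_diffs D)"
    unfolding eventually_ball_diffs
  proof (intro exI[of _ "l \<circ> T"] conjI ballI impI)
    show "finite (range (l \<circ> T))"
      using l(1) by (rule finite_subset[rotated]) auto
    fix x y assume xy: "x \<in> D" "y \<in> D" "vnorm E x \<le> 1" "vnorm E y \<le> 1" "(l \<circ> T) x = (l \<circ> T) y"
    then show "P (T (x \<ominus> y))"
      using l(2) T diff contr by (metis comp_apply order_trans)
  qed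
qed


section \<open>Finite linear combinations and finite generation modulo a closed subspace\<close>

lemma vnorm_finsum_smult_le:
  assumes "finite F" "F \<subseteq> carrier E"
  shows "vnorm E (\<Oplus>f\<in>F. c f \<odot> f) \<le> (\<Sum>f\<in>F. norm (c f) * vnorm E f)"
  using assms
proof (induction F rule: finite_induct)
  case empty
  then show ?case by simp
next
  case (insert f F)
  then have c: "(\<lambda>f. c f \<odot> f) \<in> F \<rightarrow> carrier E" "f \<in> carrier E" "c f \<odot> f \<in> carrier E"
    by auto
  then have "vnorm E (c f \<odot> f \<oplus> (\<Oplus>f\<in>F. c f \<odot> f)) \<le> vnorm E (c f \<odot> f) + vnorm E (\<Oplus>f\<in>F. c f \<odot> f)"
    by (intro vnorm_triangle M.finsum_closed)
  with insert c show ?case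
    by (simp add: vnorm_smult)
qed

lemma finsum_smult_add:
  assumes "F \<subseteq> carrier E"
  shows "(\<Oplus>f\<in>F. (c f + d f) \<odot> f) = (\<Oplus>f\<in>F. c f \<odot> f) \<oplus> (\<Oplus>f\<in>F. d f \<odot> f)"
proof -
  have "(\<Oplus>f\<in>F. (c f + d f) \<odot> f) = (\<Oplus>f\<in>F. c f \<odot> f \<oplus> d f \<odot> f)"
    using assms by (intro M.finsum_cong') (auto intro!: smult_add_left)
  also have "\<dots> = (\<Oplus>f\<in>F. c f \<odot> f) \<oplus> (\<Oplus>f\<in>F. d f \<odot> f)"
    using assms by (intro M.finsum_addf) auto
  finally show ?thesis .
qed

lemma finsum_smult_delta:
  assumes "finite F" "F \<subseteq> carrier E" "g \<in> F"
  shows "(\<Oplus>f\<in>F. (if f = g then a else 0) \<odot> f) = a \<odot> g"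
proof -
  have "(\<Oplus>f\<in>F. (if f = g then a else 0) \<odot> f) = (\<Oplus>f\<in>F. if g = f then a \<odot> f else \<zero>)"
    using assms by (intro M.finsum_cong') auto
  also have "\<dots> = a \<odot> g"
    using assms by (intro M.finsum_singleton) auto
  finally show ?thesis .
qed

text \<open>Iterating \<open>x \<in> f + W + B/2\<close>, with \<open>f\<close> in a finite set \<open>F\<close> and \<open>B\<close> the unit ball, expands a
  vector \<open>x\<close> of \<open>B\<close> as a series of terms \<open>2\<^sup>-\<^sup>n (f\<^sub>n + w\<^sub>n)\<close>. Collecting equal \<open>f\<^sub>n\<close>, the sum of the first
  parts converges in the span of \<open>F\<close>, so that the second parts converge in \<open>W\<close>.\<close>

lemma finitely_generated_mod_closed_subspace:
  assumes D: "subspace_of D E" and W: "subspace_of W E" "W \<subseteq> D"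
    and closed: "\<And>x. x \<in> carrier E \<Longrightarrow> (\<And>\<epsilon>. \<epsilon> > 0 \<Longrightarrow> \<exists>w\<in>W. vnorm E (x \<ominus> w) < \<epsilon>) \<Longrightarrow> x \<in> W"
    and ev: "eventually (\<lambda>u. \<exists>w\<in>W. vnorm E (u \<ominus> w) \<le> 1 / 2) (ball_diffs D)"
  obtains F where "finite F" "F \<subseteq> D"
    "\<And>G. F \<subseteq> G \<Longrightarrow> W \<subseteq> G \<Longrightarrow> (\<And>x y. x \<in> G \<Longrightarrow> y \<in> G \<Longrightarrow> x \<oplus> y \<in> G) \<Longrightarrow>
       (\<And>c x. x \<in> G \<Longrightarrow> c \<odot> x \<in> G) \<Longrightarrow> D \<subseteq> G"
proof -
  note D' = subspaceD[OF D] and W' = subspaceD[OF W(1)]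
  define B where "B = {x \<in> D. vnorm E x \<le> 1}"
  obtain l :: "'a \<Rightarrow> nat" where l: "finite (range l)"
    "\<And>x y. x \<in> B \<Longrightarrow> y \<in> B \<Longrightarrow> l x = l y \<Longrightarrow> \<exists>w\<in>W. vnorm E ((x \<ominus> y) \<ominus> w) \<le> 1 / 2"
    using ev unfolding eventually_ball_diffs B_def by blast
  \<comment> \<open>One representative is chosen from each cell that meets \<open>B\<close>.\<close>
  define F where "F = inv_into B l ` (l ` B)"
  have F: "finite F" "F \<subseteq> B"
    unfolding F_def using l(1) by (auto intro: finite_subset[of "l ` B" "range l"] inv_into_into)
  then have FD: "F \<subseteq> D" "F \<subseteq> carrier E"
    using D' by (auto simp: B_def)
  \<comment> \<open>Here \<open>f\<close> is the representative of the cell of \<open>x\<close>, and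
    \<open>w\<close> is within 1/2 of \<open>x \<ominus> f\<close>. Doubling the remainder gives a
    point of \<open>B\<close> again; it lies in \<open>D\<close> because \<open>W\<close>
    does.\<close>
  have step: "\<exists>f\<in>F. \<exists>w\<in>W. \<exists>y\<in>B. x = f \<oplus> w \<oplus> of_real (1 / 2) \<odot> y" if "x \<in> B" for x
  proof -
    define f where "f = inv_into B l (l x)"
    have f: "f \<in> F" "f \<in> B" "l x = l f"
      using that by (auto simp: F_def f_def inv_into_into f_inv_into_f)
    then obtain w where w: "w \<in> W" "vnorm E ((x \<ominus> f) \<ominus> w) \<le> 1 / 2"
      using l(2) \<open>x \<in> B\<close> by blast
    define y where "y = of_real 2 \<odot> ((x \<ominus> f) \<ominus> w)"
    have mem: "x \<in> D" "f \<in> D" "w \<in> D" "x \<in> carrier E" "f \<in> carrier E" "w \<in> carrier E"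
      using that f w W D' by (auto simp: B_def)
    then have "y \<in> B"
      using w(2) D' by (auto simp: B_def y_def vnorm_smult)
    moreover have "of_real (1 / 2) \<odot> y = (x \<ominus> f) \<ominus> w"
      using mem by (simp add: y_def)
    then have "x = f \<oplus> w \<oplus> of_real (1 / 2) \<odot> y"
      using mem by (simp add: a_minus_def M.a_assoc M.a_lcomm[of f] M.a_lcomm[of w] M.r_neg M.r_neg2)
    ultimately show ?thesis
      using f(1) w(1) by blast
  qed
  \<comment> \<open>Real coefficients suffice, as the iteration only adds powers of 1/2 to them.
    Their convergence is then a matter of real sequences.\<close>
  define lc :: "('a \<Rightarrow> real) \<Rightarrow> 'a" where "lc c = (\<Oplus>f\<in>F. (of_real (c f) :: 'k) \<odot> f)" for c
  have lc_in [simp]: "lc c \<in> carrier E" for c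
    unfolding lc_def using FD by (intro M.finsum_closed) auto
  have lc_add: "lc (\<lambda>f. c f + d f) = lc c \<oplus> lc d" for c d
    unfolding lc_def using finsum_smult_add[OF FD(2)] by simp
  have lc_delta: "lc (\<lambda>f. if f = g then a else 0) = of_real a \<odot> g" if "g \<in> F" for g a
    unfolding lc_def using finsum_smult_delta[OF F(1) FD(2) that, of "of_real a"]
    by (simp add: if_distrib cong: if_cong)
  have lc_norm: "vnorm E (lc c) \<le> (\<Sum>f\<in>F. \<bar>c f\<bar>)" for c
  proof -
    have "vnorm E (lc c) \<le> (\<Sum>f\<in>F. \<bar>c f\<bar> * vnorm E f)"
      using vnorm_finsum_smult_le[OF F(1) FD(2), of "\<lambda>f. of_real (c f)"] by (simp add: lc_def)
    also have "\<dots> \<le> (\<Sum>f\<in>F. \<bar>c f\<bar>)"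
      using F by (intro sum_mono) (auto simp: B_def mult_left_le)
    finally show ?thesis .
  qed
  have ball: "\<exists>c. \<exists>w\<in>W. x = lc c \<oplus> w" if "x \<in> B" for x
  proof -
    \<comment> \<open>\<open>P\<close> is the invariant after \<open>n\<close> steps, with remainder
      \<open>y\<close> scaled by \<open>(1 / 2) ^ n\<close>. \<open>Q\<close> bounds the change of
      each coefficient in step \<open>n\<close>, which makes the coefficients converge.\<close>
    define P where "P n s = (case s of (c, w, y) \<Rightarrow>
      w \<in> W \<and> y \<in> B \<and> x = lc c \<oplus> w \<oplus> of_real ((1 / 2) ^ n) \<odot> y)" for n :: nat and s
    define Q where "Q n s s' = (\<forall>f. \<bar>fst s' f - fst s f\<bar> \<le> (1 / 2 :: real) ^ n)"
      for n :: nat and s s' :: "('a \<Rightarrow> real) \<times> 'a \<times> 'a"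
    have "\<exists>s. \<forall>n. P n (s n) \<and> Q n (s n) (s (Suc n))"
    proof (rule dependent_nat_choice)
      have "lc (\<lambda>_. 0) = \<zero>"
        unfolding lc_def using FD by (intro M.add.finprod_one_eqI) auto
      then show "\<exists>s. P 0 s"
        using that D' W' by (intro exI[of _ "(\<lambda>_. 0, \<zero>, x)"]) (auto simp: P_def B_def)
    next
      fix s n assume "P n s"
      then obtain c w y where s: "s = (c, w, y)" "w \<in> W" "y \<in> B"
        and x: "x = lc c \<oplus> w \<oplus> of_real ((1 / 2) ^ n) \<odot> y"
        by (auto simp: P_def split: prod.splits)
      obtain f w' y' where f: "f \<in> F" "w' \<in> W" "y' \<in> B" "y = f \<oplus> w' \<oplus> of_real (1 / 2) \<odot> y'"
        using step[OF s(3)] by blast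
      define q :: real where "q = (1 / 2) ^ n"
      define c' where "c' = (\<lambda>g. c g + (if g = f then q else 0))"
      define w'' where "w'' = w \<oplus> of_real q \<odot> w'"
      have mem: "w \<in> carrier E" "w' \<in> carrier E" "f \<in> carrier E" "y' \<in> carrier E"
        using s f W' FD D' by (auto simp: B_def)
      have "lc c' = lc c \<oplus> of_real q \<odot> f"
        using lc_delta[OF f(1)] by (simp add: c'_def lc_add)
      moreover have "of_real ((1 / 2) ^ Suc n) = (of_real q * of_real (1 / 2) :: 'k)"
        by (simp add: q_def)
      ultimately have "x = lc c' \<oplus> w'' \<oplus> of_real ((1 / 2) ^ Suc n) \<odot> y'"
        using mem unfolding x q_def[symmetric] f(4) w''_def
        by (simp add: smult_add_right M.a_ac del: of_real_divide)
      moreover have "w'' \<in> W"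
        using s f W' by (simp add: w''_def)
      ultimately have "P (Suc n) (c', w'', y')"
        using f by (simp add: P_def)
      moreover have "Q n s (c', w'', y')"
        by (simp add: Q_def s c'_def q_def)
      ultimately show "\<exists>s'. P (Suc n) s' \<and> Q n s s'"
        by blast
    qed
    then obtain s where s: "\<And>n. P n (s n)" "\<And>n. Q n (s n) (s (Suc n))"
      by blast
    define c where "c n = fst (s n)" for n
    define w where "w n = fst (snd (s n))" for n
    define y where "y n = snd (snd (s n))" for n
    have inv: "w n \<in> W" "y n \<in> B" "x = lc (c n) \<oplus> w n \<oplus> of_real ((1 / 2) ^ n) \<odot> y n" for n
      using s(1)[of n] by (auto simp: P_def c_def w_def y_def split: prod.splits)
    have "convergent (\<lambda>n. c n f)" for f
    proof -
      have "summable (\<lambda>n. c (Suc n) f - c n f)"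
        by (rule summable_comparison_test'[where g = "\<lambda>n. (1 / 2) ^ n" and N = 0])
          (use s(2) in \<open>auto simp: Q_def c_def intro: summable_geometric\<close>)
      moreover have "(\<lambda>n. \<Sum>i<n. c (Suc i) f - c i f) = (\<lambda>n. c n f - c 0 f)"
        using sum_lessThan_telescope[of "\<lambda>n. c n f"] by simp
      ultimately show ?thesis
        by (simp add: summable_iff_convergent convergent_diff_const_right_iff)
    qed
    then obtain a where a: "\<And>f. (\<lambda>n. c n f) \<longlonglongrightarrow> a f"
      unfolding convergent_def by metis
    have xE: "x \<in> carrier E"
      using that D' by (auto simp: B_def)
    \<comment> \<open>The vectors \<open>w n\<close> of \<open>W\<close> approximate
      \<open>x \<ominus> lc a\<close>: the error consists of the coefficient differences, whose sum
      over the finite set \<open>F\<close> tends to 0, and the remainder of norm at most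
      \<open>(1 / 2) ^ n\<close>.\<close>
    have "x \<ominus> lc a \<in> W"
    proof (rule closed)
      show "x \<ominus> lc a \<in> carrier E"
        using xE by simp
      fix \<epsilon> :: real assume "\<epsilon> > 0"
      have "(\<lambda>n. (\<Sum>f\<in>F. \<bar>c n f - a f\<bar>) + (1 / 2) ^ n) \<longlonglongrightarrow> (\<Sum>f\<in>F. \<bar>a f - a f\<bar>) + 0"
        by (intro tendsto_intros a LIMSEQ_power_zero) auto
      then have "eventually (\<lambda>n. (\<Sum>f\<in>F. \<bar>c n f - a f\<bar>) + (1 / 2) ^ n < \<epsilon>) sequentially"
        using \<open>\<epsilon> > 0\<close> by (intro order_tendstoD(2)) auto
      then obtain n where n: "(\<Sum>f\<in>F. \<bar>c n f - a f\<bar>) + (1 / 2) ^ n < \<epsilon>"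
        by (auto simp: eventually_sequentially)
      have mem: "w n \<in> carrier E" "y n \<in> carrier E" "vnorm E (y n) \<le> 1"
        using inv[of n] W' D' by (auto simp: B_def)
      have "lc (c n) = lc (\<lambda>f. (c n f - a f) + a f)"
        by simp
      also have "\<dots> = lc (\<lambda>f. c n f - a f) \<oplus> lc a"
        by (rule lc_add)
      finally have "(x \<ominus> lc a) \<ominus> w n =
          (lc (\<lambda>f. c n f - a f) \<oplus> lc a \<oplus> w n \<oplus> of_real ((1 / 2) ^ n) \<odot> y n) \<ominus> lc a \<ominus> w n"
        using inv(3)[of n] by simp
      also have "\<dots> = lc (\<lambda>f. c n f - a f) \<oplus> of_real ((1 / 2) ^ n) \<odot> y n"
      proof -
        let ?p = "lc (\<lambda>f. c n f - a f)" and ?q = "of_real ((1 / 2) ^ n) \<odot> y n"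
        have "?p \<oplus> lc a \<oplus> w n \<oplus> ?q = (?p \<oplus> ?q) \<oplus> (lc a \<oplus> w n)"
          using mem by (simp add: M.a_ac)
        then show ?thesis
          using mem by (simp add: diff_diff_eq)
      qed
      finally have "vnorm E ((x \<ominus> lc a) \<ominus> w n) \<le>
          vnorm E (lc (\<lambda>f. c n f - a f)) + vnorm E (of_real ((1 / 2) ^ n) \<odot> y n)"
        using mem by (simp add: vnorm_triangle)
      also have "\<dots> \<le> (\<Sum>f\<in>F. \<bar>c n f - a f\<bar>) + (1 / 2) ^ n"
        using mem by (intro add_mono lc_norm)
          (simp add: vnorm_smult norm_power norm_divide divide_le_cancel power_divide mult_left_le)
      finally show "\<exists>w\<in>W. vnorm E ((x \<ominus> lc a) \<ominus> w) < \<epsilon>"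
        using n inv(1)[of n] by (intro bexI[of _ "w n"]) auto
    qed
    moreover have "x = lc a \<oplus> (x \<ominus> lc a)"
      using xE by (simp add: a_minus_def M.a_lcomm M.r_neg)
    ultimately show ?thesis
      by blast
  qed
  show ?thesis
  proof (rule that[OF F(1) FD(1)])
    \<comment> \<open>Phrasing generation through sets \<open>G\<close> closed under the operations
      serves two uses: \<open>G\<close> may be a subspace, or the preimage in \<open>E\<close> of a
      subspace of a quotient.\<close>
    fix G assume G: "F \<subseteq> G" "W \<subseteq> G" "\<And>x y. x \<in> G \<Longrightarrow> y \<in> G \<Longrightarrow> x \<oplus> y \<in> G"
      "\<And>c x. x \<in> G \<Longrightarrow> c \<odot> x \<in> G"
    have "(\<Oplus>f\<in>F'. c f \<odot> f) \<in> G" if "finite F'" "F' \<subseteq> F" for F' c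
      using that
    proof (induction F' rule: finite_induct)
      case empty
      then show ?case using G(2) W'(2) by auto
    next
      case (insert f F')
      then have "(\<lambda>f. c f \<odot> f) \<in> F' \<rightarrow> carrier E" "f \<in> carrier E"
        using FD by auto
      with insert G show ?case
        by (simp add: subset_iff)
    qed
    then have B: "x \<in> G" if "x \<in> B" for x
      using ball[OF that] F(1) G by (auto simp: lc_def)
    show "D \<subseteq> G"
    proof
      fix x assume x: "x \<in> D"
      \<comment> \<open>The maximum with 1 keeps the divisor positive even for a vector of norm
        zero.\<close>
      define N where "N = max 1 (vnorm E x)"
      have "N \<ge> 1" "vnorm E x \<le> N"
        by (auto simp: N_def)
      then have "of_real (1 / N) \<odot> x \<in> B"
        using x D' by (auto simp: B_def vnorm_smult norm_divide divide_le_eq)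
      then have "of_real N \<odot> (of_real (1 / N) \<odot> x) \<in> G"
        using B G by blast
      with \<open>N \<ge> 1\<close> x D' show "x \<in> G"
        by simp
    qed
  qed
qed

text \<open>Otherwise the preceding lemma, with the zero subspace as \<open>W\<close>, would make
  \<open>D\<close> finitely generated. This is a form of the theorem of Riesz that the unit ball of
  an infinite-dimensional space is not totally bounded.\<close>

lemma not_eventually_ball_diffs_small:
  assumes D: "subspace_of D E" and inf: "infinite_dimensional (E\<lparr>carrier := D\<rparr>)"
  shows "\<not> eventually (\<lambda>u. vnorm E u \<le> 1 / 2) (ball_diffs D)"
proof
  interpret D: normed_space "E\<lparr>carrier := D\<rparr>"
    by (rule normed_space_subspace[OF D])
  note D' = subspaceD[OF D]
  assume ev: "eventually (\<lambda>u. vnorm E u \<le> 1 / 2) (ball_diffs D)"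
  have ev0: "eventually (\<lambda>u. \<exists>w\<in>{\<zero>}. vnorm E (u \<ominus> w) \<le> 1 / 2) (ball_diffs D)"
    using eventually_conj[OF ev eventually_ball_diffs_in[OF D]]
    by eventually_elim (auto simp: D')
  have sub0: "subspace_of {\<zero>} E"
    by (rule submoduleI) auto
  have closed0: "x \<in> {\<zero>}"
    if x: "x \<in> carrier E" "\<And>\<epsilon>. \<epsilon> > 0 \<Longrightarrow> \<exists>w\<in>{\<zero>}. vnorm E (x \<ominus> w) < \<epsilon>" for x
  proof -
    have "vnorm E x < \<epsilon>" if "\<epsilon> > 0" for \<epsilon>
      using x(1) x(2)[OF that] by simp
    then have "vnorm E x \<le> 0"
      by (meson less_irrefl not_le)
    with x(1) show ?thesis
      using vnorm_nonneg[OF x(1)] vnorm_eq_zero[OF x(1)] by simp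
  qed
  obtain F where F: "finite F" "F \<subseteq> D"
    "\<And>G. F \<subseteq> G \<Longrightarrow> {\<zero>} \<subseteq> G \<Longrightarrow> (\<And>x y. x \<in> G \<Longrightarrow> y \<in> G \<Longrightarrow> x \<oplus> y \<in> G) \<Longrightarrow>
       (\<And>c x. x \<in> G \<Longrightarrow> c \<odot> x \<in> G) \<Longrightarrow> D \<subseteq> G"
    by (rule finitely_generated_mod_closed_subspace[OF D sub0 _ closed0 ev0]) (use D'(2) in auto)
  have "lin_span (E\<lparr>carrier := D\<rparr>) F = D"
  proof
    show "lin_span (E\<lparr>carrier := D\<rparr>) F \<subseteq> D"
      using D.subspace_carrier F(2) by (auto simp: lin_span_def)
    have "D \<subseteq> G" if "subspace_of G (E\<lparr>carrier := D\<rparr>)" "F \<subseteq> G" for G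
      using F(3)[of G] D.subspaceD[OF that(1)] that(2) by simp
    then show "D \<subseteq> lin_span (E\<lparr>carrier := D\<rparr>) F"
      by (auto simp: lin_span_def)
  qed
  with F inf show False
    by (auto simp: infinite_dimensional_def)
qed

text \<open>The Riesz argument modulo \<open>Y\<close>: with \<open>W\<close> equal to
  \<open>Y\<close>, the cosets of the finite set \<open>F\<close> would span the quotient.\<close>

lemma not_eventually_ball_diffs_near_subspace:
  assumes Y: "subspace_of Y E" and closed: "closedin (norm_topology E) Y"
    and inf: "infinite_codimension E Y"
  shows "\<not> eventually (\<lambda>u. \<exists>w\<in>Y. vnorm E (u \<ominus> w) \<le> 1 / 2) (ball_diffs (carrier E))"
proof
  note Y' = subspaceD[OF Y]
  interpret Y: abelian_subgroup Y E
    by (rule abelian_subgroupI3)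
      (use Y in \<open>auto simp: additive_subgroup_def submodule_def M.abelian_group_axioms\<close>)
  let ?Q = "quotient_module E Y"
  assume ev: "eventually (\<lambda>u. \<exists>w\<in>Y. vnorm E (u \<ominus> w) \<le> 1 / 2) (ball_diffs (carrier E))"
  obtain F where F: "finite F" "F \<subseteq> carrier E"
    "\<And>G. F \<subseteq> G \<Longrightarrow> Y \<subseteq> G \<Longrightarrow> (\<And>x y. x \<in> G \<Longrightarrow> y \<in> G \<Longrightarrow> x \<oplus> y \<in> G) \<Longrightarrow>
       (\<And>c x. x \<in> G \<Longrightarrow> c \<odot> x \<in> G) \<Longrightarrow> carrier E \<subseteq> G"
    by (rule finitely_generated_mod_closed_subspace
        [OF subspace_carrier Y _ closed_subspaceD[OF closed] ev]) (use Y'(1) in auto)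
  \<comment> \<open>Scalar multiplication in \<open>quotient_module\<close> is a union over all
    representatives of a coset; it is well behaved because each of them yields the same
    coset.\<close>
  have smult_coset: "c \<odot>\<^bsub>?Q\<^esub> (Y +> x) = Y +> c \<odot> x" if x: "x \<in> carrier E" for c x
  proof -
    have eq: "Y +> c \<odot> x' = Y +> c \<odot> x" if x': "x' \<in> Y +> x" for x'
    proof -
      obtain y where y: "y \<in> Y" "x' = y \<oplus> x"
        using x' by (auto simp: a_r_coset_def')
      then have "c \<odot> x' = c \<odot> y \<oplus> c \<odot> x"
        using x Y' by (simp add: smult_add_right)
      then have "c \<odot> x' \<in> Y +> c \<odot> x"
        using y Y' by (auto simp: a_r_coset_def')
      then show ?thesis
        using x Y.a_subgroup by (intro M.a_repr_independence[symmetric]) auto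
    qed
    have "c \<odot>\<^bsub>?Q\<^esub> (Y +> x) = (\<Union>x'\<in>Y +> x. Y +> c \<odot> x')"
      by (simp add: quotient_module_def)
    also have "\<dots> = (\<Union>x'\<in>Y +> x. Y +> c \<odot> x)"
      by (rule SUP_cong) (simp_all add: eq)
    also have "\<dots> = Y +> c \<odot> x"
      using Y.a_rcos_self[OF x] by (subst UN_constant) auto
    finally show ?thesis .
  qed
  have cosets: "carrier ?Q = (\<lambda>x. Y +> x) ` carrier E"
    by (auto simp: quotient_module_def A_RCOSETS_def')
  \<comment> \<open>\<open>?Q\<close> adds cosets as the additive factor group of \<open>E\<close>
    by \<open>Y\<close> does but is a different record, so only the group axioms are carried
    over.\<close>
  have "group (add_monoid ?Q)"
    using Y.a_factorgroup_is_group
    by (simp add: quotient_module_def A_FactGroup_def' Group.group_def monoid_def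
        group_axioms_def Units_def)
  then have "subgroup (carrier ?Q) (add_monoid ?Q)"
    using group.subgroup_self by fastforce
  then have Q: "subspace_of (carrier ?Q) ?Q"
    by (intro submodule.intro submodule_axioms.intro) (auto simp: cosets smult_coset)
  have "lin_span ?Q ((\<lambda>x. Y +> x) ` F) = carrier ?Q"
  proof
    show "lin_span ?Q ((\<lambda>x. Y +> x) ` F) \<subseteq> carrier ?Q"
      using Q F(2) unfolding lin_span_def cosets by blast
    have "carrier ?Q \<subseteq> H" if H: "subspace_of H ?Q" "(\<lambda>x. Y +> x) ` F \<subseteq> H" for H
    proof -
      interpret H: submodule H "ring_of_type_algebra :: 'k ring" ?Q
        by (rule H(1))
      \<comment> \<open>The preimage of \<open>H\<close> under the quotient map takes the place of
        \<open>G\<close>.\<close>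
      have "carrier E \<subseteq> {x \<in> carrier E. Y +> x \<in> H}"
      proof (rule F(3))
        show "F \<subseteq> {x \<in> carrier E. Y +> x \<in> H}"
          using F(2) H(2) by auto
        have "Y +> y = Y" if "y \<in> Y" for y
          using that Y' Y.a_subgroup by (intro M.a_coset_join2) auto
        then show "Y \<subseteq> {x \<in> carrier E. Y +> x \<in> H}"
          using H.one_closed Y' by (auto simp: quotient_module_def)
        show "x \<oplus> y \<in> {x \<in> carrier E. Y +> x \<in> H}"
          if "x \<in> {x \<in> carrier E. Y +> x \<in> H}" "y \<in> {x \<in> carrier E. Y +> x \<in> H}" for x y
          using that H.m_closed[of "Y +> x" "Y +> y"] Y.a_rcos_sum[of x y]
          by (auto simp: quotient_module_def)
        show "c \<odot> x \<in> {x \<in> carrier E. Y +> x \<in> H}"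
          if "x \<in> {x \<in> carrier E. Y +> x \<in> H}" for c x
          using that H.smult_closed[of c "Y +> x"] by (auto simp: smult_coset)
      qed
      then show ?thesis
        by (auto simp: cosets)
    qed
    then show "carrier ?Q \<subseteq> lin_span ?Q ((\<lambda>x. Y +> x) ` F)"
      by (auto simp: lin_span_def)
  qed
  with inf F show False
    unfolding infinite_codimension_def infinite_dimensional_def cosets by blast
qed

section \<open>Essential scalars\<close>

text \<open>This replaces compactness of \<open>T - c\<close>, so that rules for sums and composites
  become rules for limits of real functions. Values are taken in \<open>E\<close>, also for
  operators into \<open>Y\<close>, so that every block can be compared with the inclusion of its
  domain.\<close>

definition ess_scalar :: "'a set \<Rightarrow> 'k \<Rightarrow> ('a \<Rightarrow> 'a) \<Rightarrow> bool" where
  "ess_scalar D c T \<longleftrightarrow> ((\<lambda>u. vnorm E (T u \<ominus> c \<odot> u)) \<longlongrightarrow> 0) (ball_diffs D)"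

lemma ess_scalarI:
  assumes D: "subspace_of D E" and T: "\<And>u. u \<in> D \<Longrightarrow> T u \<in> carrier E"
    and le: "\<And>u. u \<in> D \<Longrightarrow> vnorm E (T u \<ominus> c \<odot> u) \<le> f u"
    and lim: "(f \<longlongrightarrow> 0) (ball_diffs D)"
  shows "ess_scalar D c T"
  unfolding ess_scalar_def
proof (rule Lim_null_comparison[OF _ lim])
  show "\<forall>\<^sub>F u in ball_diffs D. norm (vnorm E (T u \<ominus> c \<odot> u)) \<le> f u"
    using eventually_ball_diffs_in[OF D]
    by eventually_elim (use le T subspaceD(1)[OF D] in \<open>simp add: vnorm_nonneg\<close>)
qed

lemma ess_scalar_cong:
  assumes D: "subspace_of D E" and T: "\<And>u. u \<in> D \<Longrightarrow> T u \<in> carrier E"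
    and eq: "\<And>u. u \<in> D \<Longrightarrow> T u = S u" and S: "ess_scalar D c S"
  shows "ess_scalar D c T"
  by (rule ess_scalarI[OF D T, where f = "\<lambda>u. vnorm E (S u \<ominus> c \<odot> u)"])
    (use eq S in \<open>simp_all add: ess_scalar_def\<close>)

lemma ess_scalar_add:
  assumes D: "subspace_of D E" and S: "\<And>u. u \<in> D \<Longrightarrow> S u \<in> carrier E"
    and T: "\<And>u. u \<in> D \<Longrightarrow> T u \<in> carrier E"
    and "ess_scalar D a S" "ess_scalar D b T"
  shows "ess_scalar D (a + b) (\<lambda>u. S u \<oplus> T u)"
proof (rule ess_scalarI[OF D])
  show "((\<lambda>u. vnorm E (S u \<ominus> a \<odot> u) + vnorm E (T u \<ominus> b \<odot> u)) \<longlongrightarrow> 0) (ball_diffs D)"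
    using assms(4,5) unfolding ess_scalar_def by (rule tendsto_add_zero)
  fix u assume u: "u \<in> D"
  note mem = S[OF u] T[OF u] subspaceD(1)[OF D u]
  have "(S u \<oplus> T u) \<ominus> (a + b) \<odot> u = (S u \<ominus> a \<odot> u) \<oplus> (T u \<ominus> b \<odot> u)"
    using mem by (simp add: diff_eq_smult smult_add_left smult_add_right M.a_ac)
  then show "vnorm E ((S u \<oplus> T u) \<ominus> (a + b) \<odot> u) \<le> vnorm E (S u \<ominus> a \<odot> u) + vnorm E (T u \<ominus> b \<odot> u)"
    using mem by (simp add: vnorm_triangle)
qed (use S T in auto)

lemma ess_scalar_smult:
  assumes D: "subspace_of D E" and T: "\<And>u. u \<in> D \<Longrightarrow> T u \<in> carrier E" and "ess_scalar D a T"
  shows "ess_scalar D (c * a) (\<lambda>u. c \<odot> T u)"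
proof (rule ess_scalarI[OF D])
  show "((\<lambda>u. norm c * vnorm E (T u \<ominus> a \<odot> u)) \<longlongrightarrow> 0) (ball_diffs D)"
    using assms(3) unfolding ess_scalar_def by (rule tendsto_mult_right_zero)
  fix u assume u: "u \<in> D"
  note mem = T[OF u] subspaceD(1)[OF D u]
  have "c \<odot> T u \<ominus> (c * a) \<odot> u = c \<odot> (T u \<ominus> a \<odot> u)"
    using mem by (simp add: diff_eq_smult smult_add_right mult_ac)
  then show "vnorm E (c \<odot> T u \<ominus> (c * a) \<odot> u) \<le> norm c * vnorm E (T u \<ominus> a \<odot> u)"
    using mem by (simp add: vnorm_smult)
qed (use T in auto)

lemma linear_maps_subspaceD:
  assumes D: "subspace_of D E" and T: "T \<in> linear_maps (E\<lparr>carrier := D\<rparr>) E"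
  shows "x \<in> D \<Longrightarrow> T x \<in> carrier E" "x \<in> D \<Longrightarrow> T (c \<odot> x) = c \<odot> T x"
    "x \<in> D \<Longrightarrow> y \<in> D \<Longrightarrow> T (x \<oplus> y) = T x \<oplus> T y"
    "x \<in> D \<Longrightarrow> y \<in> D \<Longrightarrow> T (x \<ominus> y) = T x \<ominus> T y"
proof -
  have "T y \<in> carrier E" if "y \<in> D" for y
    using T that by (auto simp: linear_maps_def)
  with T subspaceD[OF D]
  show "x \<in> D \<Longrightarrow> T x \<in> carrier E" "x \<in> D \<Longrightarrow> T (c \<odot> x) = c \<odot> T x"
    "x \<in> D \<Longrightarrow> y \<in> D \<Longrightarrow> T (x \<oplus> y) = T x \<oplus> T y"
    "x \<in> D \<Longrightarrow> y \<in> D \<Longrightarrow> T (x \<ominus> y) = T x \<ominus> T y"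
    by (simp_all add: linear_maps_def diff_eq_smult)
qed

text \<open>The reason is \<open>S T - a b = (S - a) T + a (T - b)\<close>. The second term tends to
  0 directly; for the first, \<open>T\<close> is rescaled to a contraction, which carries
  \<open>ball_diffs D\<close> to \<open>ball_diffs D'\<close>.\<close>

lemma ess_scalar_compose:
  assumes D: "subspace_of D E" and D': "subspace_of D' E"
    and S: "S \<in> linear_maps (E\<lparr>carrier := D'\<rparr>) E" and T: "T \<in> linear_maps (E\<lparr>carrier := D\<rparr>) E"
    and into: "\<And>u. u \<in> D \<Longrightarrow> T u \<in> D'"
    and bound: "\<And>u. u \<in> D \<Longrightarrow> vnorm E (T u) \<le> M * vnorm E u"
    and "ess_scalar D' a S" "ess_scalar D b T"
  shows "ess_scalar D (a * b) (\<lambda>u. S (T u))"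
proof (rule ess_scalarI[OF D])
  note S' = linear_maps_subspaceD[OF D' S] and T' = linear_maps_subspaceD[OF D T]
    and mem = subspaceD[OF D] subspaceD[OF D']
  \<comment> \<open>The bound \<open>M\<close> may be small or negative, so it is raised to at least
    1 before dividing by it.\<close>
  define N where "N = max 1 M"
  have N: "N \<ge> 1" "M \<le> N"
    by (auto simp: N_def)
  define T1 where "T1 u = of_real (1 / N) \<odot> T u" for u
  have "filterlim T1 (ball_diffs D') (ball_diffs D)"
  proof (rule filterlim_ball_diffs[OF D D'])
    show "T1 x \<in> D'" if "x \<in> D" for x
      using that into mem by (simp add: T1_def)
    show "T1 (x \<ominus> y) = T1 x \<ominus> T1 y" if "x \<in> D" "y \<in> D" for x y
      using that T' by (simp add: T1_def diff_eq_smult smult_add_right mult_ac)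
    show "vnorm E (T1 x) \<le> vnorm E x" if "x \<in> D" for x
    proof -
      have "vnorm E (T x) \<le> N * vnorm E x"
        using bound[OF that] mult_right_mono[OF N(2) vnorm_nonneg[of x]] mem(1)[OF that] by simp
      then show ?thesis
        using N T'(1)[OF that] by (simp add: T1_def vnorm_smult norm_divide field_simps)
    qed
  qed
  then have "((\<lambda>u. vnorm E (S (T1 u) \<ominus> a \<odot> T1 u)) \<longlongrightarrow> 0) (ball_diffs D)"
    using assms(7) unfolding ess_scalar_def by (rule filterlim_compose[rotated])
  then show "((\<lambda>u. N * vnorm E (S (T1 u) \<ominus> a \<odot> T1 u) + norm a * vnorm E (T u \<ominus> b \<odot> u)) \<longlongrightarrow> 0)
      (ball_diffs D)"
    using assms(8) unfolding ess_scalar_def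
    by (intro tendsto_add_zero tendsto_mult_right_zero)
  fix u assume u: "u \<in> D"
  have Tu: "T u \<in> D'" "T u \<in> carrier E" "S (T u) \<in> carrier E" "u \<in> carrier E"
    using u into S' T' mem by auto
  have T1u: "T1 u \<in> D'" "of_real N \<odot> T1 u = T u"
    using Tu N mem by (auto simp: T1_def)
  have "S (T u) \<ominus> a \<odot> T u = of_real N \<odot> (S (T1 u) \<ominus> a \<odot> T1 u)"
    using T1u mem S'
    by (simp add: T1u(2)[symmetric] diff_eq_smult smult_add_right mult_ac del: T1u(2))
  then have 1: "vnorm E (S (T u) \<ominus> a \<odot> T u) = N * vnorm E (S (T1 u) \<ominus> a \<odot> T1 u)"
    using N T1u(1) S' mem by (simp add: vnorm_smult)
  have "S (T u) \<ominus> (a * b) \<odot> u = (S (T u) \<ominus> a \<odot> T u) \<oplus> a \<odot> (T u \<ominus> b \<odot> u)"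
  proof -
    have "(- a) \<odot> T u \<oplus> (a \<odot> T u \<oplus> (- (a * b)) \<odot> u) = (- (a * b)) \<odot> u"
      using Tu smult_add_left[of "T u" "- a" a] by (simp add: M.a_assoc[symmetric])
    then show ?thesis
      using Tu by (simp add: diff_eq_smult smult_add_right M.a_assoc)
  qed
  then have "vnorm E (S (T u) \<ominus> (a * b) \<odot> u) \<le>
      vnorm E (S (T u) \<ominus> a \<odot> T u) + vnorm E (a \<odot> (T u \<ominus> b \<odot> u))"
    using Tu by (simp add: vnorm_triangle)
  then show "vnorm E (S (T u) \<ominus> (a * b) \<odot> u) \<le>
      N * vnorm E (S (T1 u) \<ominus> a \<odot> T1 u) + norm a * vnorm E (T u \<ominus> b \<odot> u)"
    using Tu by (simp add: 1 vnorm_smult)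
  show "S (T u) \<in> carrier E"
    by (rule Tu)
qed

text \<open>Along the filter \<open>vnorm E u \<le> 2\<close>, so \<open>norm c * vnorm E u\<close>
  is at most \<open>2 * M\<close> plus a small error. If \<open>norm c\<close> exceeded
  \<open>4 * M\<close>, an error below \<open>norm c / 2 - 2 * M\<close> would force
  \<open>vnorm E u \<le> 1 / 2\<close>, against infinite dimension.\<close>

lemma ess_scalar_bound:
  assumes D: "subspace_of D E" and inf: "infinite_dimensional (E\<lparr>carrier := D\<rparr>)"
    and T: "\<And>u. u \<in> D \<Longrightarrow> T u \<in> carrier E"
    and bound: "\<And>u. u \<in> D \<Longrightarrow> vnorm E (T u) \<le> M * vnorm E u" and "M \<ge> 0"
    and ess: "ess_scalar D c T"
  shows "norm c \<le> 4 * M"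
proof (rule ccontr)
  assume "\<not> norm c \<le> 4 * M"
  then have c: "norm c / 2 - 2 * M > 0"
    by simp
  then have "eventually (\<lambda>u. vnorm E (T u \<ominus> c \<odot> u) < norm c / 2 - 2 * M) (ball_diffs D)"
    using ess unfolding ess_scalar_def by (intro order_tendstoD(2))
  with eventually_ball_diffs_in[OF D]
  have "eventually (\<lambda>u. vnorm E u \<le> 1 / 2) (ball_diffs D)"
  proof eventually_elim
    fix u assume u: "u \<in> D \<and> vnorm E u \<le> 2" "vnorm E (T u \<ominus> c \<odot> u) < norm c / 2 - 2 * M"
    then have mem: "u \<in> carrier E" "T u \<in> carrier E"
      using subspaceD(1)[OF D] T by auto
    have "c \<odot> u = T u \<ominus> (T u \<ominus> c \<odot> u)"
    proof -
      have "T u \<oplus> (- 1) \<odot> T u = \<zero>"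
        using mem smult_add_left[of "T u" 1 "- 1"] by simp
      then show ?thesis
        using mem by (simp add: diff_eq_smult smult_add_right M.a_assoc[symmetric])
    qed
    then have "norm c * vnorm E u \<le> vnorm E (T u) + vnorm E (T u \<ominus> c \<odot> u)"
      using mem by (metis vnorm_diff_le vnorm_smult smult_in_carrier M.minus_closed)
    also have "vnorm E (T u) \<le> M * 2"
      using bound[of u] u(1) \<open>M \<ge> 0\<close> by (meson mult_left_mono order_trans)
    finally have "norm c * vnorm E u \<le> norm c * (1 / 2)"
      using u(2) by simp
    then show "vnorm E u \<le> 1 / 2"
      using c \<open>M \<ge> 0\<close> by (subst (asm) mult_le_cancel_left_pos) auto
  qed
  with not_eventually_ball_diffs_small[OF D inf] show False
    by blast
qed

text \<open>The difference of two essential scalars is one for the zero operator, where the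
  preceding bound applies with \<open>M\<close> equal to 0.\<close>

lemma ess_scalar_unique:
  assumes D: "subspace_of D E" and inf: "infinite_dimensional (E\<lparr>carrier := D\<rparr>)"
    and T: "\<And>u. u \<in> D \<Longrightarrow> T u \<in> carrier E" and a: "ess_scalar D a T" and b: "ess_scalar D b T"
  shows "a = b"
proof -
  have ess: "ess_scalar D (a + - 1 * b) (\<lambda>u. T u \<oplus> (- 1) \<odot> T u)"
    using T by (intro ess_scalar_add ess_scalar_smult D a b) auto
  have zero: "\<zero> = T u \<oplus> (- 1) \<odot> T u" if "u \<in> D" for u
    using T[OF that] smult_add_left[of "T u" 1 "- 1"] by simp
  have "ess_scalar D (a + - 1 * b) (\<lambda>_. \<zero>)"
    by (rule ess_scalar_cong[OF D _ zero ess]) auto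
  from ess_scalar_bound[OF D inf _ _ _ this, of 0] show ?thesis
    by simp
qed

text \<open>If \<open>c\<close> were nonzero, then along the filter \<open>u\<close> would be within
  1/2 of \<open>inverse c \<odot> T u\<close>, a vector of \<open>Y\<close>. Infinite codimension
  excludes this.\<close>

lemma ess_scalar_into_closed_subspace:
  assumes Y: "subspace_of Y E" and closed: "closedin (norm_topology E) Y"
    and inf: "infinite_codimension E Y"
    and T: "\<And>u. u \<in> carrier E \<Longrightarrow> T u \<in> Y" and ess: "ess_scalar (carrier E) c T"
  shows "c = 0"
proof (rule ccontr)
  assume "c \<noteq> 0"
  then have "norm c / 2 > 0"
    by simp
  then have "eventually (\<lambda>u. vnorm E (T u \<ominus> c \<odot> u) < norm c / 2) (ball_diffs (carrier E))"
    using ess unfolding ess_scalar_def by (intro order_tendstoD(2))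
  with eventually_ball_diffs_in[OF subspace_carrier]
  have "eventually (\<lambda>u. \<exists>w\<in>Y. vnorm E (u \<ominus> w) \<le> 1 / 2) (ball_diffs (carrier E))"
  proof eventually_elim
    fix u assume u: "u \<in> carrier E \<and> vnorm E u \<le> 2" "vnorm E (T u \<ominus> c \<odot> u) < norm c / 2"
    then have mem: "u \<in> carrier E" "T u \<in> Y" "T u \<in> carrier E"
      using subspaceD(1)[OF Y] T by auto
    have "T u \<ominus> c \<odot> u = (- c) \<odot> (u \<ominus> inverse c \<odot> T u)"
      using mem \<open>c \<noteq> 0\<close> by (simp add: diff_eq_smult smult_add_right M.a_comm)
    then have "norm c * vnorm E (u \<ominus> inverse c \<odot> T u) < norm c * (1 / 2)"
      using u(2) mem by (simp add: vnorm_smult)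
    then have "vnorm E (u \<ominus> inverse c \<odot> T u) < 1 / 2"
      using \<open>c \<noteq> 0\<close> by (subst (asm) mult_less_cancel_left_pos) auto
    then show "\<exists>w\<in>Y. vnorm E (u \<ominus> w) \<le> 1 / 2"
      using subspaceD(3)[OF Y mem(2)] by (meson less_imp_le)
  qed
  with not_eventually_ball_diffs_near_subspace[OF Y closed inf] show False
    by blast
qed

text \<open>The image of the unit ball under the compact part is totally bounded. Labelling
  \<open>x\<close> by a ball of radius \<open>\<epsilon> / 2\<close> that contains
  \<open>K x\<close> gives a finite partition on whose cells \<open>K\<close> varies by less than
  \<open>\<epsilon>\<close>.\<close>

lemma ess_scalar_scalar_plus_compact:
  assumes D: "subspace_of D E" and "scalar_plus_compact (E\<lparr>carrier := D\<rparr>) E (\<lambda>x\<in>D. x) T"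
  shows "\<exists>c. ess_scalar D c T"
proof -
  interpret Metric_space "carrier E" "vdist E"
    by (rule Metric_space_vdist)
  note D' = subspaceD[OF D]
  obtain c K where K: "K \<in> compact_operators (E\<lparr>carrier := D\<rparr>) E"
    and T: "T = c \<odot>\<^bsub>operator_space (E\<lparr>carrier := D\<rparr>) E\<^esub> (\<lambda>x\<in>D. x) \<oplus>\<^bsub>operator_space (E\<lparr>carrier := D\<rparr>) E\<^esub> K"
    using assms(2) by (auto simp: scalar_plus_compact_def)
  have Kl: "K \<in> linear_maps (E\<lparr>carrier := D\<rparr>) E"
    using K by (simp add: compact_operators_def)
  note K' = linear_maps_subspaceD[OF D Kl]
  have T_eq: "T u = K u \<oplus> c \<odot> u" if "u \<in> D" for u
    using that K' D' by (simp add: T operator_space_def M.a_comm)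
  have "ess_scalar D c T"
    unfolding ess_scalar_def
  proof (rule order_tendstoI)
    fix a :: real assume "a < 0"
    show "eventually (\<lambda>u. a < vnorm E (T u \<ominus> c \<odot> u)) (ball_diffs D)"
      using eventually_ball_diffs_in[OF D]
    proof eventually_elim
      fix u assume "u \<in> D \<and> vnorm E u \<le> 2"
      then have "vnorm E (T u \<ominus> c \<odot> u) \<ge> 0"
        using T_eq K' D' by (simp add: vnorm_nonneg)
      with \<open>a < 0\<close> show "a < vnorm E (T u \<ominus> c \<odot> u)"
        by simp
    qed
  next
    fix \<epsilon> :: real assume "0 < \<epsilon>"
    let ?B = "{x \<in> D. vnorm E x \<le> 1}"
    have "mtotally_bounded (mtopology closure_of (K ` ?B))"
      using K by (intro compactin_imp_mtotally_bounded)
        (auto simp: compact_operators_def norm_topology_def)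
    moreover have sub: "K ` ?B \<subseteq> mtopology closure_of (K ` ?B)"
      using K' by (intro closure_of_subset) auto
    ultimately obtain C where C: "finite C" "K ` ?B \<subseteq> (\<Union>x\<in>C. mball x (\<epsilon> / 2))"
      using \<open>0 < \<epsilon>\<close> unfolding mtotally_bounded_def by (meson half_gt_zero subset_trans)
    \<comment> \<open>The centres are numbered injectively, so that equal labels mean equal
      centres.\<close>
    obtain \<phi> :: "'a \<Rightarrow> nat" where \<phi>: "inj_on \<phi> C"
      using finite_imp_inj_to_nat_seg[OF C(1)] by blast
    have "\<forall>x\<in>?B. \<exists>k\<in>C. K x \<in> mball k (\<epsilon> / 2)"
      using C(2) by blast
    then obtain g where "\<forall>x\<in>?B. g x \<in> C \<and> K x \<in> mball (g x) (\<epsilon> / 2)"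
      unfolding Bex_def by (rule bchoice[THEN exE])
    then have g: "g x \<in> C" "K x \<in> mball (g x) (\<epsilon> / 2)" if "x \<in> ?B" for x
      using that by blast+
    \<comment> \<open>The value 0 off the unit ball keeps the range finite. It may coincide with the
      number of a centre, since labels are compared only inside the ball.\<close>
    define l where "l x = (if x \<in> ?B then \<phi> (g x) else 0)" for x
    have "range l \<subseteq> insert 0 (\<phi> ` C)"
      using g by (auto simp: l_def)
    then have fin: "finite (range l)"
      using C(1) by (meson finite_imageI finite_insert finite_subset)
    have "T (x \<ominus> y) \<ominus> c \<odot> (x \<ominus> y) = K x \<ominus> K y" if "x \<in> D" "y \<in> D" for x y
      using that T_eq[of "x \<ominus> y"] K' D' by simp
    moreover have "vnorm E (K x \<ominus> K y) < \<epsilon>" if "x \<in> ?B" "y \<in> ?B" "l x = l y" for x y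
    proof -
      have "g x = g y"
        using that g(1) inj_onD[OF \<phi>] by (simp add: l_def)
      then have "vdist E (K x) (K y) < \<epsilon>"
        using g(2)[OF that(1)] g(2)[OF that(2)] triangle'[of "K x" "g x" "K y"] by (auto simp: commute)
      then show ?thesis
        using that K' by (simp add: vdist_def)
    qed
    ultimately show "eventually (\<lambda>u. vnorm E (T u \<ominus> c \<odot> u) < \<epsilon>) (ball_diffs D)"
      unfolding eventually_ball_diffs by (intro exI[of _ l] conjI fin) auto
  qed
  then show ?thesis
    by blast
qed

lemma ess_scalar_zero:
  assumes "subspace_of D E"
  shows "ess_scalar D 0 (\<lambda>_. \<zero>)"
  by (rule ess_scalarI[OF assms, where f = "\<lambda>_. 0"]) (simp_all add: subspaceD(1)[OF assms])

lemma ess_scalar_id: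
  assumes "subspace_of D E"
  shows "ess_scalar D 1 (\<lambda>x. x)"
  by (rule ess_scalarI[OF assms, where f = "\<lambda>_. 0"])
    (simp_all add: subspaceD(1)[OF assms] a_minus_def M.r_neg)

end

section \<open>Operators on a direct sum\<close>

lemma normed_space_max_sum:
  fixes E :: "('k::real_or_complex, 'a, 'm) normed_module_scheme"
    and F :: "('k, 'b, 'n) normed_module_scheme"
  assumes "normed_space E" and "normed_space F"
  shows "normed_space (max_sum E F)"
proof -
  interpret E: normed_space E by fact
  interpret F: normed_space F by fact
  have "abelian_group (max_sum E F)"
  proof (rule abelian_groupI)
    show "\<exists>y\<in>carrier (max_sum E F). y \<oplus>\<^bsub>max_sum E F\<^esub> x = \<zero>\<^bsub>max_sum E F\<^esub>"
      if "x \<in> carrier (max_sum E F)" for x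
      using that
      by (intro bexI[of _ "(\<ominus>\<^bsub>E\<^esub> fst x, \<ominus>\<^bsub>F\<^esub> snd x)"])
        (auto simp: max_sum_def E.M.l_neg F.M.l_neg)
  qed (auto simp: max_sum_def E.M.a_ac F.M.a_ac)
  then have "module (ring_of_type_algebra :: 'k ring) (max_sum E F)"
    by (intro moduleI cring_from_type_algebra)
      (auto simp: max_sum_def E.smult_add_left F.smult_add_left E.smult_add_right F.smult_add_right)
  then interpret module "ring_of_type_algebra :: 'k ring" "max_sum E F" .
  show ?thesis
  proof
    fix x y assume x: "x \<in> carrier (max_sum E F)"
    show "0 \<le> vnorm (max_sum E F) x"
      using x by (auto simp: max_sum_def E.vnorm_nonneg le_max_iff_disj)
    show "vnorm (max_sum E F) x = 0 \<longleftrightarrow> x = \<zero>\<^bsub>max_sum E F\<^esub>"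
      using x E.vnorm_nonneg[of "fst x"] F.vnorm_nonneg[of "snd x"]
        E.vnorm_eq_zero[of "fst x"] F.vnorm_eq_zero[of "snd x"]
      by (auto simp: max_sum_def max_def split: if_splits)
    show "vnorm (max_sum E F) (c \<odot>\<^bsub>max_sum E F\<^esub> x) = norm c * vnorm (max_sum E F) x" for c
      using x by (auto simp: max_sum_def E.vnorm_smult F.vnorm_smult max_mult_distrib_left)
    assume y: "y \<in> carrier (max_sum E F)"
    show "vnorm (max_sum E F) (x \<oplus>\<^bsub>max_sum E F\<^esub> y) \<le> vnorm (max_sum E F) x + vnorm (max_sum E F) y"
      using x y E.vnorm_triangle[of "fst x" "fst y"] F.vnorm_triangle[of "snd x" "snd y"]
      by (auto simp: max_sum_def)
  qed
qed

section \<open>The operator norm and the operations on bounded operators\<close>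

lemma vnorm_operator_bound:
  assumes "normed_space E" and "normed_space F" and T: "T \<in> bounded_operators E F"
  shows "x \<in> carrier E \<Longrightarrow> vnorm F (T x) \<le> vnorm (operator_space E F) T * vnorm E x"
    and "0 \<le> vnorm (operator_space E F) T"
proof -
  interpret E: normed_space E by fact
  interpret F: normed_space F by fact
  obtain C where C: "\<And>x. x \<in> carrier E \<Longrightarrow> vnorm F (T x) \<le> C * vnorm E x"
    using T by (auto simp: bounded_operators_def)
  have Tl: "T x \<in> carrier F" "T (c \<odot>\<^bsub>E\<^esub> x) = c \<odot>\<^bsub>F\<^esub> T x" if "x \<in> carrier E" for x c
    using T that by (auto simp: bounded_operators_def linear_maps_def)
  let ?B = "{x \<in> carrier E. vnorm E x \<le> 1}"
  have "vnorm F (T x) \<le> \<bar>C\<bar>" if "x \<in> ?B" for x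
  proof -
    have "C * vnorm E x \<le> \<bar>C\<bar> * 1"
      using that E.vnorm_nonneg[of x] by (intro mult_mono) auto
    with C[of x] that show ?thesis
      by simp
  qed
  then have bdd: "bdd_above ((\<lambda>x. vnorm F (T x)) ` ?B)"
    by (rule bdd_aboveI2)
  have ball: "vnorm F (T x) \<le> vnorm (operator_space E F) T" if "x \<in> ?B" for x
    using cSUP_upper[OF that bdd] by (simp add: operator_space_def)
  show "0 \<le> vnorm (operator_space E F) T"
    using ball[of "\<zero>\<^bsub>E\<^esub>"] F.vnorm_nonneg[OF Tl(1), of "\<zero>\<^bsub>E\<^esub>"] by simp
  assume x: "x \<in> carrier E"
  show "vnorm F (T x) \<le> vnorm (operator_space E F) T * vnorm E x"
  \<comment> \<open>A vector of norm zero cannot be normalised; there the constant \<open>C\<close>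
    gives the bound directly.\<close>
  proof (cases "vnorm E x = 0")
    case True
    with C[OF x] show ?thesis
      by simp
  next
    case False
    then have pos: "vnorm E x > 0"
      using E.vnorm_nonneg[OF x] by simp
    have "vnorm F (T (of_real (1 / vnorm E x) \<odot>\<^bsub>E\<^esub> x)) \<le> vnorm (operator_space E F) T"
      using pos x by (intro ball) (auto simp: E.vnorm_smult norm_divide)
    with pos Tl[OF x] show ?thesis
      by (simp add: F.vnorm_smult norm_divide field_simps)
  qed
qed

lemma bounded_operators_closed:
  assumes "normed_space E" and "normed_space F"
    and S: "S \<in> bounded_operators E F" and T: "T \<in> bounded_operators E F"
  shows "S \<oplus>\<^bsub>operator_space E F\<^esub> T \<in> bounded_operators E F"
    and "c \<odot>\<^bsub>operator_space E F\<^esub> T \<in> bounded_operators E F"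
proof -
  interpret E: normed_space E by fact
  interpret F: normed_space F by fact
  have l: "R x \<in> carrier F" "R (c \<odot>\<^bsub>E\<^esub> x) = c \<odot>\<^bsub>F\<^esub> R x"
    "y \<in> carrier E \<Longrightarrow> R (x \<oplus>\<^bsub>E\<^esub> y) = R x \<oplus>\<^bsub>F\<^esub> R y"
    if "R \<in> bounded_operators E F" "x \<in> carrier E" for R x y c
    using that by (auto simp: bounded_operators_def linear_maps_def)
  note b = vnorm_operator_bound(1)[OF assms(1,2)]
  have "S \<oplus>\<^bsub>operator_space E F\<^esub> T \<in> linear_maps E F"
    by (auto simp: linear_maps_def operator_space_def l[OF S] l[OF T] F.smult_add_right F.M.a_ac)
  moreover have "vnorm F ((S \<oplus>\<^bsub>operator_space E F\<^esub> T) x) \<le>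
      (vnorm (operator_space E F) S + vnorm (operator_space E F) T) * vnorm E x"
    if "x \<in> carrier E" for x
    using F.vnorm_triangle[OF l(1)[OF S that] l(1)[OF T that]] b[OF S that] b[OF T that] that
    by (simp add: distrib_right) (simp add: operator_space_def)
  ultimately show "S \<oplus>\<^bsub>operator_space E F\<^esub> T \<in> bounded_operators E F"
    by (auto simp: bounded_operators_def)
  have "c \<odot>\<^bsub>operator_space E F\<^esub> T \<in> linear_maps E F"
    by (auto simp: linear_maps_def operator_space_def l[OF T] F.smult_add_right mult.commute)
  moreover have "vnorm F ((c \<odot>\<^bsub>operator_space E F\<^esub> T) x) \<le>
      (norm c * vnorm (operator_space E F) T) * vnorm E x" if "x \<in> carrier E" for x
  proof -
    have "vnorm F ((c \<odot>\<^bsub>operator_space E F\<^esub> T) x) = norm c * vnorm F (T x)"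
      using that l(1)[OF T that] by (simp add: operator_space_def F.vnorm_smult)
    then show ?thesis
      using mult_left_mono[OF b[OF T that], of "norm c"] by (simp add: mult.assoc)
  qed
  ultimately show "c \<odot>\<^bsub>operator_space E F\<^esub> T \<in> bounded_operators E F"
    by (auto simp: bounded_operators_def)
qed

lemma bounded_operators_compose:
  assumes "normed_space E" "normed_space F" "normed_space G"
    and S: "S \<in> bounded_operators F G" and T: "T \<in> bounded_operators E F"
  shows "compose (carrier E) S T \<in> bounded_operators E G"
proof -
  interpret E: normed_space E by fact
  have T_in: "T x \<in> carrier F" if "x \<in> carrier E" for x
    using T that by (auto simp: bounded_operators_def linear_maps_def)
  have "compose (carrier E) S T \<in> linear_maps E G"
    using S T by (auto simp: linear_maps_def bounded_operators_def compose_def Pi_iff PiE_iff)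
  moreover have "vnorm G (compose (carrier E) S T x) \<le>
      (vnorm (operator_space F G) S * vnorm (operator_space E F) T) * vnorm E x"
    if x: "x \<in> carrier E" for x
  proof -
    have "vnorm G (S (T x)) \<le> vnorm (operator_space F G) S * vnorm F (T x)"
      by (rule vnorm_operator_bound(1)[OF assms(2,3) S T_in[OF x]])
    also have "\<dots> \<le> vnorm (operator_space F G) S * (vnorm (operator_space E F) T * vnorm E x)"
      by (rule mult_left_mono[OF vnorm_operator_bound(1)[OF assms(1,2) T x]
            vnorm_operator_bound(2)[OF assms(2,3) S]])
    finally show ?thesis
      using x by (simp add: compose_def mult.assoc)
  qed
  ultimately show ?thesis
    by (auto simp: bounded_operators_def)
qed

section \<open>Essential matrices of operators on \<open>Z\<close>\<close>

text \<open>Both summands are kept as subspaces of the one space \<open>E\<close>. All four blocks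
  of an operator then become maps into \<open>E\<close> and can be treated alike.\<close>

locale scalar_plus_compact_pair = normed_space E
  for E :: "('k::real_or_complex, 'a, 'm) normed_module_scheme" (structure) +
  fixes Y :: "'a set"
  assumes subspace_Y: "subspace_of Y E"
    and closed_Y: "closedin (norm_topology E) Y"
    and infinite_dimensional_E: "infinite_dimensional E"
    and infinite_dimensional_Y: "infinite_dimensional (E\<lparr>carrier := Y\<rparr>)"
    and infinite_codimension_Y: "infinite_codimension E Y"
    and scalar_plus_compact_E:
      "T \<in> bounded_operators E E \<Longrightarrow> scalar_plus_compact E E (\<lambda>x\<in>carrier E. x) T"
    and scalar_plus_compact_Y:
      "T \<in> bounded_operators (E\<lparr>carrier := Y\<rparr>) E \<Longrightarrow>
       scalar_plus_compact (E\<lparr>carrier := Y\<rparr>) E (\<lambda>x\<in>Y. x) T"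
begin

abbreviation Z :: "('k, 'a \<times> 'a) normed_module" where
  "Z \<equiv> max_sum E (E\<lparr>carrier := Y\<rparr>)"

text \<open>The index \<open>True\<close> stands for the first summand of \<open>Z\<close> and \<open>False\<close> for the second one.\<close>

definition summand :: "bool \<Rightarrow> 'a set" where
  "summand j = (if j then carrier E else Y)"

definition emb :: "bool \<Rightarrow> 'a \<Rightarrow> 'a \<times> 'a" where
  "emb j x = (if j then (x, \<zero>) else (\<zero>, x))"

definition proj :: "bool \<Rightarrow> 'a \<times> 'a \<Rightarrow> 'a" where
  "proj i z = (if i then fst z else snd z)"

text \<open>The row \<open>i\<close> is the target summand, the column \<open>j\<close> the source.
  The restriction makes a block an operator in the sense of \<open>linear_maps\<close>.\<close>

definition block :: "('a \<times> 'a \<Rightarrow> 'a \<times> 'a) \<Rightarrow> bool \<Rightarrow> bool \<Rightarrow> 'a \<Rightarrow> 'a" where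
  "block T i j = (\<lambda>x\<in>summand j. proj i (T (emb j x)))"

text \<open>For bounded \<open>T\<close> the description is proper: existence comes from the
  scalar-plus-compact hypotheses, uniqueness from the infinite dimension of each summand.\<close>

definition entry :: "('a \<times> 'a \<Rightarrow> 'a \<times> 'a) \<Rightarrow> bool \<Rightarrow> bool \<Rightarrow> 'k" where
  "entry T i j = (THE c. ess_scalar (summand j) c (block T i j))"

lemma Z_normed_space: "normed_space Z"
  by (intro normed_space_max_sum normed_space_subspace subspace_Y normed_space_axioms)

lemma summand_subspace: "subspace_of (summand j) E"
  by (simp add: summand_def subspace_Y subspace_carrier)

lemmas summandD = subspaceD[OF summand_subspace]

lemma summand_infinite_dimensional: "infinite_dimensional (E\<lparr>carrier := summand j\<rparr>)"
  by (simp add: summand_def infinite_dimensional_E infinite_dimensional_Y)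

lemma emb_simps:
  assumes "x \<in> summand j"
  shows "emb j x \<in> carrier Z" "vnorm Z (emb j x) = vnorm E x" "emb j (c \<odot> x) = c \<odot>\<^bsub>Z\<^esub> emb j x"
    "y \<in> summand j \<Longrightarrow> emb j (x \<oplus> y) = emb j x \<oplus>\<^bsub>Z\<^esub> emb j y"
  using assms subspaceD[OF subspace_Y]
  by (auto simp: emb_def summand_def max_sum_def max_absorb1 max_absorb2 vnorm_nonneg split: if_splits)

lemma proj_simps:
  assumes "z \<in> carrier Z"
  shows "proj i z \<in> summand i" "vnorm E (proj i z) \<le> vnorm Z z" "proj i (c \<odot>\<^bsub>Z\<^esub> z) = c \<odot> proj i z"
    "w \<in> carrier Z \<Longrightarrow> proj i (z \<oplus>\<^bsub>Z\<^esub> w) = proj i z \<oplus> proj i w"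
  using assms by (auto simp: proj_def summand_def max_sum_def)

lemma emb_proj:
  assumes "z \<in> carrier Z"
  shows "z = emb True (proj True z) \<oplus>\<^bsub>Z\<^esub> emb False (proj False z)"
  using assms subspaceD[OF subspace_Y] by (auto simp: emb_def proj_def max_sum_def)

lemma operatorD:
  assumes "T \<in> bounded_operators Z Z" "z \<in> carrier Z"
  shows "T z \<in> carrier Z" "T (c \<odot>\<^bsub>Z\<^esub> z) = c \<odot>\<^bsub>Z\<^esub> T z"
    "w \<in> carrier Z \<Longrightarrow> T (z \<oplus>\<^bsub>Z\<^esub> w) = T z \<oplus>\<^bsub>Z\<^esub> T w"
  using assms by (auto simp: bounded_operators_def linear_maps_def)

lemma block_into:
  assumes "T \<in> bounded_operators Z Z" "x \<in> summand j"
  shows "block T i j x \<in> summand i"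
  using assms by (simp add: block_def emb_simps operatorD proj_simps)

lemma block_carrier:
  "T \<in> bounded_operators Z Z \<Longrightarrow> x \<in> summand j \<Longrightarrow> block T i j x \<in> carrier E"
  by (rule summandD(1)[OF block_into])

lemma block_vnorm_le:
  assumes "T \<in> bounded_operators Z Z" "x \<in> summand j"
  shows "vnorm E (block T i j x) \<le> vnorm (operator_space Z Z) T * vnorm E x"
proof -
  have "vnorm E (block T i j x) \<le> vnorm Z (T (emb j x))"
    using assms by (simp add: block_def emb_simps operatorD proj_simps)
  also have "\<dots> \<le> vnorm (operator_space Z Z) T * vnorm Z (emb j x)"
    using assms by (intro vnorm_operator_bound(1) Z_normed_space emb_simps)
  finally show ?thesis
    using assms by (simp add: emb_simps)
qed

lemma block_bounded_operator:
  assumes T: "T \<in> bounded_operators Z Z"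
  shows "block T i j \<in> bounded_operators (E\<lparr>carrier := summand j\<rparr>) E"
proof -
  have "block T i j \<in> linear_maps (E\<lparr>carrier := summand j\<rparr>) E"
    using block_carrier[OF T, of _ j i]
    by (auto simp: linear_maps_def summandD)
      (simp_all add: block_def summandD emb_simps operatorD[OF T] proj_simps)
  then show ?thesis
    using block_vnorm_le[OF T] by (auto simp: bounded_operators_def)
qed

lemma entry_eqI:
  assumes "\<And>x. x \<in> summand j \<Longrightarrow> block T i j x \<in> carrier E"
    and "ess_scalar (summand j) c (block T i j)"
  shows "entry T i j = c"
  unfolding entry_def
  by (rule the_equality[where P = "\<lambda>c. ess_scalar (summand j) c (block T i j)", OF assms(2)])
    (rule ess_scalar_unique[OF summand_subspace summand_infinite_dimensional assms(1) _ assms(2)])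

text \<open>The column decides which hypothesis supplies the scalar: the one on operators on
  \<open>E\<close> or the one on operators from \<open>Y\<close> to \<open>E\<close>. Both rows are
  covered because \<open>Y\<close> lies in \<open>E\<close>.\<close>

lemma ess_scalar_entry:
  assumes T: "T \<in> bounded_operators Z Z"
  shows "ess_scalar (summand j) (entry T i j) (block T i j)"
proof -
  have "scalar_plus_compact (E\<lparr>carrier := summand j\<rparr>) E (\<lambda>x\<in>summand j. x) (block T i j)"
    using block_bounded_operator[OF T, of i j] scalar_plus_compact_E scalar_plus_compact_Y
    by (cases j) (auto simp: summand_def)
  then obtain c where "ess_scalar (summand j) c (block T i j)"
    using ess_scalar_scalar_plus_compact[OF summand_subspace] by blast
  moreover from this have "entry T i j = c"
    using block_into[OF T] summandD(1) by (intro entry_eqI) blast+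
  ultimately show ?thesis
    by simp
qed

lemma entry_eqI':
  assumes "\<And>x. x \<in> summand j \<Longrightarrow> block T i j x = f x" "\<And>x. x \<in> summand j \<Longrightarrow> f x \<in> carrier E"
    and "ess_scalar (summand j) c f"
  shows "entry T i j = c"
proof (rule entry_eqI)
  show mem: "block T i j x \<in> carrier E" if "x \<in> summand j" for x
    using assms(1,2)[OF that] by simp
  show "ess_scalar (summand j) c (block T i j)"
    by (rule ess_scalar_cong[OF summand_subspace mem assms(1,3)])
qed

text \<open>This estimate makes the module actions and the derivation below bounded.\<close>

lemma norm_entry_le:
  assumes T: "T \<in> bounded_operators Z Z"
  shows "norm (entry T i j) \<le> 4 * vnorm (operator_space Z Z) T"
  by (rule ess_scalar_bound[OF summand_subspace summand_infinite_dimensional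
        block_carrier[OF T] block_vnorm_le[OF T]
        vnorm_operator_bound(2)[OF Z_normed_space Z_normed_space T] ess_scalar_entry[OF T]])

lemma entry_add:
  assumes S: "S \<in> bounded_operators Z Z" and T: "T \<in> bounded_operators Z Z"
  shows "entry (S \<oplus>\<^bsub>operator_space Z Z\<^esub> T) i j = entry S i j + entry T i j"
proof (rule entry_eqI')
  show "ess_scalar (summand j) (entry S i j + entry T i j) (\<lambda>x. block S i j x \<oplus> block T i j x)"
    by (intro ess_scalar_add summand_subspace block_carrier ess_scalar_entry S T)
  show "block (S \<oplus>\<^bsub>operator_space Z Z\<^esub> T) i j x = block S i j x \<oplus> block T i j x"
    if "x \<in> summand j" for x
    using that by (simp add: block_def operator_space_def emb_simps operatorD S T proj_simps)
  show "block S i j x \<oplus> block T i j x \<in> carrier E" if "x \<in> summand j" for x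
    using that by (intro M.a_closed block_carrier S T)
qed

lemma entry_smult:
  assumes T: "T \<in> bounded_operators Z Z"
  shows "entry (c \<odot>\<^bsub>operator_space Z Z\<^esub> T) i j = c * entry T i j"
proof (rule entry_eqI')
  show "ess_scalar (summand j) (c * entry T i j) (\<lambda>x. c \<odot> block T i j x)"
    by (intro ess_scalar_smult summand_subspace block_carrier ess_scalar_entry T)
  show "block (c \<odot>\<^bsub>operator_space Z Z\<^esub> T) i j x = c \<odot> block T i j x"
    if "x \<in> summand j" for x
    using that by (simp add: block_def operator_space_def emb_simps operatorD T proj_simps)
  show "c \<odot> block T i j x \<in> carrier E" if "x \<in> summand j" for x
    using that by (intro smult_in_carrier block_carrier T)
qed

text \<open>Blocks multiply like matrices, and essential scalars are additive and
  multiplicative.\<close>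

lemma entry_compose:
  assumes S: "S \<in> bounded_operators Z Z" and T: "T \<in> bounded_operators Z Z"
  shows "entry (compose (carrier Z) S T) i j =
    entry S i True * entry T True j + entry S i False * entry T False j"
proof (rule entry_eqI')
  have lin: "block R i j \<in> linear_maps (E\<lparr>carrier := summand j\<rparr>) E"
    if "R \<in> bounded_operators Z Z" for R i j
    using block_bounded_operator[OF that] by (simp add: bounded_operators_def)
  have mem: "block S i k (block T k j x) \<in> carrier E" if "x \<in> summand j" for x k
    using that by (intro block_carrier[OF S] block_into[OF T])
  have ess: "ess_scalar (summand j) (entry S i k * entry T k j) (\<lambda>x. block S i k (block T k j x))" for k
    by (rule ess_scalar_compose[OF summand_subspace summand_subspace lin[OF S] lin[OF T]
          block_into[OF T] block_vnorm_le[OF T] ess_scalar_entry[OF S] ess_scalar_entry[OF T]])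
  show "ess_scalar (summand j) (entry S i True * entry T True j + entry S i False * entry T False j)
      (\<lambda>x. block S i True (block T True j x) \<oplus> block S i False (block T False j x))"
    by (intro ess_scalar_add summand_subspace mem ess)
  fix x assume x: "x \<in> summand j"
  show "block S i True (block T True j x) \<oplus> block S i False (block T False j x) \<in> carrier E"
    using x by (intro M.a_closed mem)
  have z: "emb j x \<in> carrier Z" "T (emb j x) \<in> carrier Z"
    using x T by (simp_all add: emb_simps operatorD)
  have "S (T (emb j x)) = S (emb True (proj True (T (emb j x))) \<oplus>\<^bsub>Z\<^esub> emb False (proj False (T (emb j x))))"
    using emb_proj[OF z(2)] by simp
  also have "\<dots> = S (emb True (proj True (T (emb j x)))) \<oplus>\<^bsub>Z\<^esub> S (emb False (proj False (T (emb j x))))"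
    by (rule operatorD(3)[OF S]) (simp_all add: emb_simps proj_simps z)
  finally show "block (compose (carrier Z) S T) i j x =
      block S i True (block T True j x) \<oplus> block S i False (block T False j x)"
    using x z S
    by (simp add: block_def compose_def emb_simps proj_simps operatorD)
qed

text \<open>This block maps \<open>E\<close> into \<open>Y\<close>, where infinite codimension
  leaves no room for a nonzero scalar. The essential matrix is therefore upper triangular and its
  diagonal entries are multiplicative.\<close>

lemma entry_lower_left:
  assumes T: "T \<in> bounded_operators Z Z"
  shows "entry T False True = 0"
proof (rule ess_scalar_into_closed_subspace[OF subspace_Y closed_Y infinite_codimension_Y])
  show "ess_scalar (carrier E) (entry T False True) (block T False True)"
    using ess_scalar_entry[OF T, of True False] by (simp add: summand_def)
  show "block T False True u \<in> Y" if "u \<in> carrier E" for u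
    using block_into[OF T, of u True False] that by (simp add: summand_def)
qed

end

section \<open>A one-dimensional bimodule\<close>

text \<open>The class axiom provides real coordinates with respect to 1 and \<open>i\<close> that do
  not increase distances. Completeness of the reals thus passes to the scalar field; in the real
  case the second coordinate is 0.\<close>

lemma real_or_complex_Cauchy_convergent:
  fixes \<sigma> :: "nat \<Rightarrow> 'k::real_or_complex"
  assumes "Cauchy \<sigma>"
  shows "convergent \<sigma>"
proof -
  obtain i :: 'k and a b where ab: "\<And>z. z = a z *\<^sub>R 1 + b z *\<^sub>R i"
    "\<And>z w. \<bar>a z - a w\<bar> \<le> norm (z - w)" "\<And>z w. \<bar>b z - b w\<bar> \<le> norm (z - w)"
  proof -
    consider "\<forall>z::'k. \<exists>a. z = a *\<^sub>R 1"
      | i :: 'k where "\<forall>z::'k. \<exists>a b. z = a *\<^sub>R 1 + b *\<^sub>R i"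
        "\<forall>a b. norm (a *\<^sub>R 1 + b *\<^sub>R i) = sqrt (a\<^sup>2 + b\<^sup>2)"
      using real_or_complex by blast
    then show thesis
    proof cases
      case 1
      then obtain a where a: "\<And>z::'k. z = a z *\<^sub>R 1"
        by metis
      have "norm (z - w) = \<bar>a z - a w\<bar>" for z w
      proof -
        have "z - w = (a z - a w) *\<^sub>R 1"
          using a[of z] a[of w] by (metis scaleR_left_diff_distrib)
        then show ?thesis
          by simp
      qed
      then show thesis
        using a that[of a "\<lambda>_. 0" 0] by simp
    next
      case (2 i)
      then obtain a b where ab: "\<And>z::'k. z = a z *\<^sub>R 1 + b z *\<^sub>R i"
        by metis
      have "norm (z - w) = sqrt ((a z - a w)\<^sup>2 + (b z - b w)\<^sup>2)" for z w
      proof -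
        have "z - w = (a z *\<^sub>R 1 + b z *\<^sub>R i) - (a w *\<^sub>R 1 + b w *\<^sub>R i)"
          using ab[of z] ab[of w] by simp
        also have "\<dots> = (a z - a w) *\<^sub>R 1 + (b z - b w) *\<^sub>R i"
          by (simp add: algebra_simps)
        finally show ?thesis
          using 2(2) by simp
      qed
      then show thesis
        using that[OF ab] by simp
    qed
  qed
  have conv: "convergent (\<lambda>n. g (\<sigma> n))" if "\<And>z w. \<bar>g z - g w\<bar> \<le> norm (z - w)" for g :: "'k \<Rightarrow> real"
  proof -
    have "Cauchy (\<lambda>n. g (\<sigma> n))"
      using \<open>Cauchy \<sigma>\<close> that unfolding Cauchy_def dist_norm real_norm_def
      by (meson le_less_trans)
    then show ?thesis
      by (simp add: Cauchy_convergent_iff)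
  qed
  obtain A B where "(\<lambda>n. a (\<sigma> n)) \<longlonglongrightarrow> A" "(\<lambda>n. b (\<sigma> n)) \<longlonglongrightarrow> B"
    using conv[OF ab(2)] conv[OF ab(3)] by (auto simp: convergent_def)
  then have "(\<lambda>n. a (\<sigma> n) *\<^sub>R 1 + b (\<sigma> n) *\<^sub>R i) \<longlonglongrightarrow> A *\<^sub>R 1 + B *\<^sub>R i"
    by (intro tendsto_intros)
  then show ?thesis
    unfolding ab(1)[symmetric] by (rule convergentI)
qed

text \<open>The scalar field as a Banach space whose carrier lies in a function type, as the definition
  of amenability demands.\<close>

definition const_space :: "('k::real_or_complex, 'b \<Rightarrow> 'k) normed_module" where
  "const_space =
     \<lparr>carrier = range (\<lambda>c _. c), mult = undefined, one = undefined,
      zero = (\<lambda>_. 0), add = (\<lambda>f g t. f t + g t), smult = (\<lambda>c f t. c * f t),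
      vnorm = (\<lambda>f. norm (f undefined))\<rparr>"

lemma const_space_simps [simp]:
  "carrier const_space = range (\<lambda>c _. c)" "\<zero>\<^bsub>const_space\<^esub> = (\<lambda>_. 0)"
  "f \<oplus>\<^bsub>const_space\<^esub> g = (\<lambda>t. f t + g t)" "c \<odot>\<^bsub>const_space\<^esub> f = (\<lambda>t. c * f t)"
  "vnorm const_space f = norm (f undefined)"
  by (simp_all add: const_space_def)

text \<open>Evaluating constant functions at the arbitrary point \<open>undefined\<close> is an
  isometry onto the scalar field, so completeness carries over.\<close>

lemma banach_space_const_space:
  "banach_space (const_space :: ('k::real_or_complex, 'b \<Rightarrow> 'k) normed_module)"
proof -
  let ?E = "const_space :: ('k, 'b \<Rightarrow> 'k) normed_module"
  have "abelian_group ?E"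
  proof (rule abelian_groupI)
    show "\<exists>y\<in>carrier ?E. y \<oplus>\<^bsub>?E\<^esub> x = \<zero>\<^bsub>?E\<^esub>" if "x \<in> carrier ?E" for x
      using that by (intro bexI[of _ "\<lambda>t. - x t"]) auto
  qed (auto simp: add_ac)
  then have "module (ring_of_type_algebra :: 'k ring) ?E"
    by (intro moduleI cring_from_type_algebra) (auto simp: algebra_simps)
  then interpret module "ring_of_type_algebra :: 'k ring" ?E .
  interpret normed_space ?E
  proof
    show "0 \<le> vnorm ?E f" for f
      by simp
    show "vnorm ?E f = 0 \<longleftrightarrow> f = \<zero>\<^bsub>?E\<^esub>" if "f \<in> carrier ?E" for f
      using that by (auto simp: fun_eq_iff)
    show "vnorm ?E (f \<oplus>\<^bsub>?E\<^esub> g) \<le> vnorm ?E f + vnorm ?E g" for f g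
      by (simp add: norm_triangle_ineq)
    show "vnorm ?E (c \<odot>\<^bsub>?E\<^esub> f) = norm c * vnorm ?E f" for c f
      by (simp add: norm_mult)
  qed
  interpret Metric_space "carrier ?E" "vdist ?E"
    by (rule Metric_space_vdist)
  have dist: "vdist ?E f g = dist (f undefined) (g undefined)"
    if "f \<in> carrier ?E" "g \<in> carrier ?E" for f g
    using that by (simp add: vdist_def diff_eq_smult dist_norm)
  have "mcomplete"
    unfolding mcomplete_def
  proof (intro allI impI)
    fix \<sigma> assume \<sigma>: "MCauchy \<sigma>"
    then have mem: "\<sigma> n \<in> carrier ?E" for n
      unfolding MCauchy_def by blast
    have "\<forall>\<epsilon>>0. \<exists>N. \<forall>n n'. N \<le> n \<longrightarrow> N \<le> n' \<longrightarrow> dist (\<sigma> n undefined) (\<sigma> n' undefined) < \<epsilon>"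
      using \<sigma> unfolding MCauchy_def dist[OF mem mem] by (rule conjunct2)
    then have "Cauchy (\<lambda>n. \<sigma> n undefined)"
      by (simp add: Cauchy_def)
    then obtain L where L: "(\<lambda>n. \<sigma> n undefined) \<longlonglongrightarrow> L"
      using real_or_complex_Cauchy_convergent by (auto simp: convergent_def)
    have L_mem: "(\<lambda>_. L) \<in> carrier ?E"
      by simp
    have "limitin mtopology \<sigma> (\<lambda>_. L) sequentially"
      unfolding limit_metric_sequentially dist[OF mem L_mem]
      using L mem L_mem by (simp add: lim_sequentially del: const_space_simps)
    then show "\<exists>x. limitin mtopology \<sigma> x sequentially"
      by blast
  qed
  then show ?thesis
    by (simp add: banach_space_def normed_space_axioms del: const_space_simps)
qed

section \<open>The upper right entry as a derivation that is not inner\<close>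

context scalar_plus_compact_pair
begin

text \<open>The entries \<open>\<alpha>, \<beta>, \<gamma>\<close> of the essential upper triangular matrix of an operator satisfy
  \<open>\<beta>(ST) = \<alpha>(S) \<beta>(T) + \<beta>(S) \<gamma>(T)\<close>, so \<open>\<beta>\<close> is a derivation into the scalar field with left action
  \<open>\<alpha>\<close> and right action \<open>\<gamma>\<close>.\<close>

lemma not_amenable_operator_algebra: "\<not> amenable (operator_algebra Z)"
proof
  let ?A = "operator_algebra Z"
  define V :: "('k, ('a \<times> 'a \<Rightarrow> 'a \<times> 'a) \<Rightarrow> 'k) normed_module" where "V = const_space"
  \<comment> \<open>Passing to the dual swaps the sides: its left action comes from
    \<open>r\<close>, which therefore carries \<alpha>, and its right action from \<open>l\<close>,
    which carries \<gamma>.\<close>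
  define l where "l = (\<lambda>T (x :: ('a \<times> 'a \<Rightarrow> 'a \<times> 'a) \<Rightarrow> 'k) t. entry T False False * x t)"
  define r where "r = (\<lambda>(x :: ('a \<times> 'a \<Rightarrow> 'a \<times> 'a) \<Rightarrow> 'k) T t. entry T True True * x t)"
  \<comment> \<open>\<open>x undefined\<close> is the value of the constant function
    \<open>x\<close>. Thus \<open>D T\<close> is \<beta> of \<open>T\<close> times the functional
    that identifies \<open>V\<close> with the scalars.\<close>
  define D where "D = (\<lambda>T\<in>bounded_operators Z Z. \<lambda>x\<in>carrier V. entry T True False * x undefined)"
  have A: "carrier ?A = bounded_operators Z Z" "S \<otimes>\<^bsub>?A\<^esub> T = compose (carrier Z) S T"
    "S \<oplus>\<^bsub>?A\<^esub> T = S \<oplus>\<^bsub>operator_space Z Z\<^esub> T" "c \<odot>\<^bsub>?A\<^esub> T = c \<odot>\<^bsub>operator_space Z Z\<^esub> T"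
    "vnorm ?A T = vnorm (operator_space Z Z) T" for S T c
    by (simp_all add: operator_algebra_def operator_space_def)
  have closed: "compose (carrier Z) S T \<in> bounded_operators Z Z"
    "S \<oplus>\<^bsub>operator_space Z Z\<^esub> T \<in> bounded_operators Z Z"
    "c \<odot>\<^bsub>operator_space Z Z\<^esub> T \<in> bounded_operators Z Z"
    if "S \<in> bounded_operators Z Z" "T \<in> bounded_operators Z Z" for S T c
    by (rule bounded_operators_compose[OF Z_normed_space Z_normed_space Z_normed_space that]
        bounded_operators_closed[OF Z_normed_space Z_normed_space that])+
  have bound: "norm (entry T i j * c) \<le> 4 * vnorm (operator_space Z Z) T * norm c"
    if "T \<in> bounded_operators Z Z" for T i j c
    using norm_entry_le[OF that] by (simp add: norm_mult mult_right_mono)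
  have "banach_bimodule ?A V l r"
    unfolding banach_bimodule_def bounded_bilinear_map_def
  proof (intro conjI ballI)
    show "banach_space V"
      unfolding V_def by (rule banach_space_const_space)
    show "\<exists>C. \<forall>T\<in>carrier ?A. \<forall>x\<in>carrier V. vnorm V (l T x) \<le> C * vnorm ?A T * vnorm V x"
      using bound by (intro exI[of _ 4]) (auto simp: A V_def l_def)
    show "\<exists>C. \<forall>x\<in>carrier V. \<forall>T\<in>carrier ?A. vnorm V (r x T) \<le> C * vnorm V x * vnorm ?A T"
      using bound by (intro exI[of _ 4]) (auto simp: A V_def r_def mult_ac)
  \<comment> \<open>The module laws need multiplicative diagonal entries, hence
    \<open>entry_lower_left\<close>.\<close>
  qed (auto simp: linear_maps_def A V_def l_def r_def entry_add entry_smult entry_compose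
      entry_lower_left closed algebra_simps)
  moreover have "bounded_derivation ?A (dual_space V) (dual_left_action V r) (dual_right_action V l) D"
    unfolding bounded_derivation_def
  proof (intro conjI ballI)
    have D_mem: "D T \<in> carrier (dual_space V)" if "T \<in> bounded_operators Z Z" for T
    proof -
      have "(\<lambda>x\<in>carrier V. c * x undefined) \<in> carrier (dual_space V)" for c
        by (auto simp: dual_space_def operator_space_def bounded_operators_def linear_maps_def
            V_def scalar_space_def norm_mult algebra_simps intro!: exI[of _ "norm c"])
      with that show ?thesis
        by (simp add: D_def)
    qed
    have D_norm: "vnorm (dual_space V) (D T) \<le> 4 * vnorm (operator_space Z Z) T"
      if "T \<in> bounded_operators Z Z" for T
    proof -
      have "vnorm (dual_space V) (D T) =
          (SUP x\<in>{x \<in> carrier V. vnorm V x \<le> 1}. norm (entry T True False * x undefined))"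
        using that by (auto simp: dual_space_def operator_space_def scalar_space_def D_def intro!: SUP_cong)
      also have "\<dots> \<le> 4 * vnorm (operator_space Z Z) T"
      proof (rule cSUP_least)
        show "{x \<in> carrier V. vnorm V x \<le> 1} \<noteq> {}"
          by (auto simp: V_def intro!: exI[of _ 0])
        fix x assume "x \<in> {x \<in> carrier V. vnorm V x \<le> 1}"
        then have "4 * vnorm (operator_space Z Z) T * norm (x undefined) \<le> 4 * vnorm (operator_space Z Z) T * 1"
          using vnorm_operator_bound(2)[OF Z_normed_space Z_normed_space that]
          by (intro mult_left_mono) (auto simp: V_def)
        with bound[OF that, of True False "x undefined"]
        show "norm (entry T True False * x undefined) \<le> 4 * vnorm (operator_space Z Z) T"
          by simp
      qed
      finally show ?thesis .
    qed
    have dual: "f \<oplus>\<^bsub>dual_space V\<^esub> g = (\<lambda>x\<in>carrier V. f x + g x)"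
      "c \<odot>\<^bsub>dual_space V\<^esub> f = (\<lambda>x\<in>carrier V. c * f x)" for f g c
      by (simp_all add: dual_space_def operator_space_def scalar_space_def)
    have "D \<in> linear_maps ?A (dual_space V)"
      unfolding linear_maps_def
    proof (intro CollectI conjI ballI allI)
      show "D \<in> carrier ?A \<rightarrow>\<^sub>E carrier (dual_space V)"
        using D_mem by (intro PiE_I) (simp_all add: A, simp add: D_def)
      fix S T c assume T: "T \<in> carrier ?A"
      show "D (c \<odot>\<^bsub>?A\<^esub> T) = c \<odot>\<^bsub>dual_space V\<^esub> D T"
        using T unfolding dual A by (simp add: D_def closed entry_smult mult.assoc cong: restrict_cong)
      assume "S \<in> carrier ?A"
      with T show "D (S \<oplus>\<^bsub>?A\<^esub> T) = D S \<oplus>\<^bsub>dual_space V\<^esub> D T"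
        unfolding dual A by (simp add: D_def closed entry_add distrib_right cong: restrict_cong)
    qed
    with D_norm show "D \<in> bounded_operators ?A (dual_space V)"
      by (auto simp: bounded_operators_def A)
    fix S T assume ST: "S \<in> carrier ?A" "T \<in> carrier ?A"
    have "r x S \<in> carrier V" "l T x \<in> carrier V" if "x \<in> carrier V" for x
      using that by (auto simp: V_def r_def l_def)
    with ST show "D (S \<otimes>\<^bsub>?A\<^esub> T) =
        dual_left_action V r S (D T) \<oplus>\<^bsub>dual_space V\<^esub> dual_right_action V l (D S) T"
      unfolding dual A dual_left_action_def dual_right_action_def
      by (simp add: D_def closed entry_compose cong: restrict_cong)
        (simp add: r_def l_def algebra_simps)
  qed
  moreover assume "amenable ?A"
  ultimately have "inner_derivation ?A (dual_space V) (dual_left_action V r) (dual_right_action V l) D"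
    unfolding amenable_def by blast
  then obtain v where v: "v \<in> carrier (dual_space V)"
    "\<And>T. T \<in> bounded_operators Z Z \<Longrightarrow>
      D T = dual_left_action V r T v \<ominus>\<^bsub>dual_space V\<^esub> dual_right_action V l v T"
    unfolding inner_derivation_def A by blast
  \<comment> \<open>This copies the second summand into the first. Its only nonzero block is the
    inclusion of \<open>Y\<close>, so both actions of \<open>T\<close> on the dual vanish while
    \<open>D T\<close> does not.\<close>
  define T where "T = (\<lambda>z\<in>carrier Z. (snd z, \<zero>))"
  have T: "T \<in> bounded_operators Z Z"
  proof -
    have "T \<in> linear_maps Z Z"
      using subspaceD[OF subspace_Y] by (auto simp: linear_maps_def T_def max_sum_def)
    moreover have "vnorm Z (T z) \<le> 1 * vnorm Z z" if "z \<in> carrier Z" for z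
      using that subspaceD(1)[OF subspace_Y] by (auto simp: T_def max_sum_def vnorm_nonneg le_max_iff_disj)
    ultimately show ?thesis
      unfolding bounded_operators_def by blast
  qed
  have one: "entry T True False = 1"
    by (rule entry_eqI'[OF _ _ ess_scalar_id[OF summand_subspace]])
      (simp_all add: block_def T_def emb_simps summandD, simp add: emb_def proj_def)
  have zero: "entry T i i = 0" for i
    by (rule entry_eqI'[OF _ _ ess_scalar_zero[OF summand_subspace]])
      (simp_all add: block_def T_def emb_simps, simp add: emb_def proj_def)
  have "v (0 \<odot>\<^bsub>V\<^esub> x) = 0" if "x \<in> carrier V" for x
    using v(1) that by (simp add: dual_space_def operator_space_def bounded_operators_def
        linear_maps_def scalar_space_def)
  from this[of "\<lambda>_. 0"] have v0: "v (\<lambda>_. 0) = 0"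
    by (simp add: V_def)
  let ?zero = "\<lambda>x\<in>carrier V. 0 :: 'k"
  have act: "dual_left_action V r T v = ?zero" "dual_right_action V l v T = ?zero"
    by (simp_all add: dual_left_action_def dual_right_action_def r_def l_def zero v0)
  \<comment> \<open>The additive inverse is given by a description, and no group structure on the
    dual has been established here, so the inverse of zero is computed by hand.\<close>
  have "\<ominus>\<^bsub>dual_space V\<^esub> ?zero = ?zero"
    unfolding a_inv_def m_inv_def
  proof (rule the_equality)
    show "?zero \<in> carrier (add_monoid (dual_space V)) \<and>
      ?zero \<otimes>\<^bsub>add_monoid (dual_space V)\<^esub> ?zero = \<one>\<^bsub>add_monoid (dual_space V)\<^esub> \<and>
      ?zero \<otimes>\<^bsub>add_monoid (dual_space V)\<^esub> ?zero = \<one>\<^bsub>add_monoid (dual_space V)\<^esub>"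
      by (auto simp: dual_space_def operator_space_def bounded_operators_def linear_maps_def
          scalar_space_def V_def fun_eq_iff intro!: exI[of _ 0])
    fix f assume f: "f \<in> carrier (add_monoid (dual_space V)) \<and>
      ?zero \<otimes>\<^bsub>add_monoid (dual_space V)\<^esub> f = \<one>\<^bsub>add_monoid (dual_space V)\<^esub> \<and>
      f \<otimes>\<^bsub>add_monoid (dual_space V)\<^esub> ?zero = \<one>\<^bsub>add_monoid (dual_space V)\<^esub>"
    show "f = ?zero"
    proof (rule extensionalityI[of _ "carrier V"])
      show "f \<in> extensional (carrier V)"
        using f by (auto simp: dual_space_def operator_space_def bounded_operators_def linear_maps_def
            PiE_iff)
      have "(\<lambda>x\<in>carrier V. ?zero x + f x) = ?zero"
        using f by (simp add: dual_space_def operator_space_def scalar_space_def)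
      then show "f x = ?zero x" if "x \<in> carrier V" for x
        using that by (auto dest!: fun_cong[of _ _ x])
    qed simp
  qed
  then have "D T = ?zero"
    using v(2)[OF T]
    by (simp add: act a_minus_def) (simp add: dual_space_def operator_space_def scalar_space_def
        restrict_def fun_eq_iff)
  \<comment> \<open>The constant function 1 separates \<open>D T\<close> from the zero
    functional.\<close>
  moreover have "D T (\<lambda>_. 1) = 1" and "?zero (\<lambda>_. 1) = 0"
    using T one by (simp_all add: D_def V_def)
  ultimately show False
    by simp
qed

end

theorem proposition1p6:
  fixes X_AH :: "('k::real_or_complex, 'x) normed_module"
    and e :: "nat \<Rightarrow> 'x"
    and Y :: "'x set"
  assumes "banach_space X_AH"
    and "very_few_operators X_AH"
    and "shrinking_basis X_AH e"
    and "isomorphic_spaces (dual_space X_AH) (ell1 :: ('k, nat \<Rightarrow> 'k) normed_module)"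
    and "submodule Y (ring_of_type_algebra :: 'k ring) X_AH"
    and "closedin (norm_topology X_AH) Y"
    and "infinite_dimensional (X_AH\<lparr>carrier := Y\<rparr>)"
    and "\<exists>s :: nat \<Rightarrow> nat. strict_mono s \<and> Y = closed_span X_AH (range (e \<circ> s))"
    and "infinite_codimension X_AH Y"
    and "isomorphic_spaces (dual_space (X_AH\<lparr>carrier := Y\<rparr>)) (ell1 :: ('k, nat \<Rightarrow> 'k) normed_module)"
    and "\<forall>T\<in>bounded_operators (X_AH\<lparr>carrier := Y\<rparr>) X_AH.
           scalar_plus_compact (X_AH\<lparr>carrier := Y\<rparr>) X_AH (\<lambda>x\<in>Y. x) T"
  shows "\<not> amenable (operator_algebra (max_sum X_AH (X_AH\<lparr>carrier := Y\<rparr>)))"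
proof -
  interpret normed_space X_AH
    using assms(1) by (simp add: banach_space_def)
  interpret scalar_plus_compact_pair X_AH Y
  proof (intro scalar_plus_compact_pair.intro scalar_plus_compact_pair_axioms.intro)
    show "infinite_dimensional X_AH"
      using assms(2) unfolding very_few_operators_def by (rule conjunct1)
    show "scalar_plus_compact X_AH X_AH (\<lambda>x\<in>carrier X_AH. x) T"
      if "T \<in> bounded_operators X_AH X_AH" for T
      using assms(2) that unfolding very_few_operators_def by blast
  qed (fact normed_space_axioms assms(5-7,9) bspec[OF assms(11)])+
  show ?thesis
    by (rule not_amenable_operator_algebra)
qed

end
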